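(* The following hold. (i) $S_{\mathrm{bd}}(n+4)=S_{\mathrm{bd}}(n)+\sqrt{2}$ for every integer $n\geq 4$. (ii) $S_{\mathrm{bd}}(4)=2$, and if $\mathcal{F}$ is a family of $4$ unit squares covering the boundary of a square $S$ of edge length $2$, then every element of $\mathcal{F}$ is homothetic to $S$. (iii) $S_{\mathrm{bd}}(5)=\frac12\sqrt2\sqrt{\sqrt{13-8\sqrt2}+1}+1$ (approximately $2.072$). Furthermore, if $\mathcal{F}$ is a family of $5$ unit squares covering the boundary of a square $S$ of edge length $S_{\mathrm{bd}}(5)$, then the configuration formed by $S$ and $\mathcal{F}$ is congruent to the following one. Let $\bar{x}=\frac12\sqrt2\sqrt{\sqrt{13-8\sqrt2}+1}$, $a=1+\bar{x}$, and $\theta=\arccos\frac{1}{\bar{x}}$. The covered square is $[0,a]^2$, and the five unit squares are: (1) $[0,1]^2$; (2) the square obtained from $[0,1]^2$ by rotating it about the origin by the angle $-\theta$ (i.e. clockwise by $\theta$) and then translating it by $(1,0)$; (3) the reflection of the square in (2) in the line $y=x$; (4) the unit square one of whose diagonals is the segment with endpoints $(a,a-\sqrt2)$ and $(a,a)$; (5) the unit square one of whose diagonals is the segment with endpoints $(a-\sqrt2,a)$ and $(a,a)$. That is, there is an isometry of $\mathbb{R}^2$ mapping $S$ to $[0,a]^2$ and mapping $\mathcal{F}$ to the family consisting of these five unit squares.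
   Context: All squares are closed (solid) squares in the Euclidean plane $\mathbb{R}^2$, arbitrarily positioned and oriented; a unit square is a square of edge length $1$. A family of sets covers a set $X$ if $X$ is contained in the union of the family. For an integer $n\ge 2$, $S_{\mathrm{bd}}(n)$ denotes the largest value such that the boundary of a square of edge length $S_{\mathrm{bd}}(n)$ can be covered by $n$ unit squares. A square is homothetic to $S$ if it is the image of $S$ under a translation or homothety; equivalently, its sides are parallel to those of $S$. *)

theory Defs
  imports "HOL-Analysis.Analysis"
begin

definition is_square :: "real \<Rightarrow> (real^2) set \<Rightarrow> bool" where
  "is_square s Q \<longleftrightarrow> s > 0 \<and>
     (\<exists>p u v. norm u = 1 \<and> norm v = 1 \<and> u \<bullet> v = 0 \<and>
        Q = {p + x *\<^sub>R u + y *\<^sub>R v | x y. 0 \<le> x \<and> x \<le> s \<and> 0 \<le> y \<and> y \<le> s})"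

(* A family of n squares is an indexed family F 0, ..., F (n - 1); repetitions are allowed. *)

definition unit_square_family :: "nat \<Rightarrow> (nat \<Rightarrow> (real^2) set) \<Rightarrow> bool" where
  "unit_square_family n F \<longleftrightarrow> (\<forall>i<n. is_square 1 (F i))"

definition covers :: "nat \<Rightarrow> (nat \<Rightarrow> 'a set) \<Rightarrow> 'a set \<Rightarrow> bool" where
  "covers n F X \<longleftrightarrow> X \<subseteq> (\<Union>i<n. F i)"

(* GREATEST carries no information unless a greatest value exists, so an evaluation such as
   S_bd 4 = 2 has to establish that the maximum is attained. *)

definition S_bd :: "nat \<Rightarrow> real" where
  "S_bd n = (GREATEST s. \<exists>S F. is_square s S \<and> unit_square_family n F \<and> covers n F (frontier S))"

definition homothetic :: "(real^2) set \<Rightarrow> (real^2) set \<Rightarrow> bool" where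
  "homothetic Q S \<longleftrightarrow>
     (\<exists>t. Q = (\<lambda>p. p + t) ` S) \<or>
     (\<exists>c k. k \<noteq> 0 \<and> Q = (\<lambda>p. c + k *\<^sub>R (p - c)) ` S)"

definition plane_isometry :: "(real^2 \<Rightarrow> real^2) \<Rightarrow> bool" where
  "plane_isometry g \<longleftrightarrow> (\<forall>p q. dist (g p) (g q) = dist p q)"

(* Counterclockwise rotation about the origin. *)

definition rotation :: "real \<Rightarrow> real^2 \<Rightarrow> real^2" where
  "rotation \<phi> p = vector [cos \<phi> * p$1 - sin \<phi> * p$2, sin \<phi> * p$1 + cos \<phi> * p$2]"

definition square_with_diagonal :: "real^2 \<Rightarrow> real^2 \<Rightarrow> (real^2) set" where
  "square_with_diagonal p q =
     (let m = midpoint p q; w = rotation (pi / 2) (q - m) in convex hull {p, m + w, q, m - w})"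

definition axis_square :: "real \<Rightarrow> (real^2) set" where
  "axis_square s = cbox (vector [0, 0]) (vector [s, s])"

definition x_bar :: real where
  "x_bar = 1 / 2 * sqrt 2 * sqrt (sqrt (13 - 8 * sqrt 2) + 1)"

definition a_bar :: real where
  "a_bar = 1 + x_bar"

definition theta_bar :: real where
  "theta_bar = arccos (1 / x_bar)"

definition tilted_square :: "(real^2) set" where
  "tilted_square = (\<lambda>p. rotation (- theta_bar) p + vector [1, 0]) ` axis_square 1"

definition five_squares :: "(real^2) set set" where
  "five_squares =
     {axis_square 1,
      tilted_square,
      (\<lambda>p. vector [p$2, p$1]) ` tilted_square,
      square_with_diagonal (vector [a_bar, a_bar - sqrt 2]) (vector [a_bar, a_bar]),
      square_with_diagonal (vector [a_bar - sqrt 2, a_bar]) (vector [a_bar, a_bar])}"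

end

theory Submission
  imports Defs
begin

text \<open>A unit square has diameter \<open>sqrt 2\<close>, so as soon as the edge length \<open>s\<close> of the big square \<open>S\<close>
exceeds \<open>sqrt 2\<close>, a unit square meets at most two sides of \<open>S\<close>, and these are adjacent. A unit
square that contains a corner of \<open>S\<close> reaches lengths \<open>r\<close> and \<open>q\<close> along the two sides there; the
possible pairs form an explicit compact set \<open>corner_reach\<close>, whose boundary is given by the function
\<open>short_reach u = u - u * sqrt (u\<^sup>2 - 1)\<close> for \<open>u \<ge> 1\<close> (lemmas \<open>unit_square_corner_reach\<close> and
\<open>corner_reach_attained\<close>).

The main step turns coverings into a finite-dimensional problem. Suppose that two or more squares
meet both sides at a corner. None of them gets farther than \<open>sqrt 2\<close> from the corner on either side,
so two of them may be replaced by one square with a diagonal on the first side and one with a diagonal on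
the second, which together do at least as well. Such a pair amounts
to one corner square with reach \<open>(sqrt 2, 0)\<close> and one spare segment of length \<open>sqrt 2\<close>. Hence \<open>n\<close> unit
squares can cover the boundary if and only if there is a \<open>reach_scheme\<close>: four corner reaches, and \<open>n - 4\<close>
spare segments distributed over the sides, such that on every side the two reaches and the spare
segments add up to at least \<open>s\<close> (lemma \<open>coverable_iff_reach_scheme\<close>). By compactness a largest \<open>s\<close>
exists.

All three claims follow from the schemes. Four more squares give one more spare segment to each side.
Conversely, if \<open>s > 2 * sqrt 2\<close>, then two reaches do not suffice for a side, so every side has a spare
segment that can be removed; and any \<open>s \<le> 2 * sqrt 2\<close> is below \<open>S_bd n + sqrt 2\<close>, because \<open>2 \<le> S_bd n\<close>.
For \<open>n = 4\<close>, the reaches at a corner have sum at most \<open>2\<close>, with equality only for \<open>(1, 1)\<close>, and that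
pair determines the corner square. For \<open>n = 5\<close>, three sides have no spare segment, and following the
constraints along them forces the reaches to be \<open>(sqrt 2, 0)\<close>, \<open>(short_reach x_bar, x_bar)\<close>, \<open>(1, 1)\<close>,
\<open>(x_bar, short_reach x_bar)\<close> up to reflection (theorem \<open>one_segment_rigidity\<close>). Each of
the last three pairs is realised by only one square, so the squares at three corners are determined. At
the remaining corner two squares are left to cover length \<open>sqrt 2\<close> on both sides, and each of them must
have its diagonal there.\<close>

section \<open>Isometries of the plane\<close>

abbreviation pt :: "real \<Rightarrow> real \<Rightarrow> real^2" where "pt x y \<equiv> vector [x, y]"

lemma pt_eq_iff: "z = w \<longleftrightarrow> z$1 = w$1 \<and> z$2 = (w$2 :: real)" for z w :: "real^2"
  by (simp add: vec_eq_iff forall_2)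

lemma pt_components [simp]: "pt (z$1) (z$2) = z"
  by (simp add: pt_eq_iff)

lemma dist_plane: "dist z w = sqrt ((z$1 - w$1)\<^sup>2 + (z$2 - w$2)\<^sup>2)" for z w :: "real^2"
  by (simp add: dist_norm norm_vec_def L2_set_def sum_2)

lemma inner_plane: "z \<bullet> w = z$1 * w$1 + z$2 * w$2" for z w :: "real^2"
  by (simp add: inner_vec_def sum_2)

lemma norm_plane: "norm z = sqrt ((z$1)\<^sup>2 + (z$2)\<^sup>2)" for z :: "real^2"
  by (simp add: norm_vec_def L2_set_def sum_2)

lemma plane_isometry_affine:
  assumes "plane_isometry g"
  obtains L where "orthogonal_transformation L" "g = (\<lambda>z. L z + g 0)"
proof -
  define L where "L z = g z - g 0" for z
  have "orthogonal_transformation L"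
    unfolding orthogonal_transformation_isometry
    using assms by (auto simp: L_def plane_isometry_def dist_norm)
  moreover have "g = (\<lambda>z. L z + g 0)" by (auto simp: L_def)
  ultimately show ?thesis using that by blast
qed

lemma plane_isometry_bij: assumes "plane_isometry g" shows "bij g"
proof -
  obtain L where L: "orthogonal_transformation L" "g = (\<lambda>z. L z + g 0)"
    using plane_isometry_affine[OF assms] by blast
  have "bij L" using L(1) orthogonal_transformation_bij by blast
  moreover have "bij (\<lambda>z. z + g 0)" by (rule bij_plus_right)
  ultimately have "bij ((\<lambda>z. z + g 0) \<circ> L)" by (rule bij_comp)
  then have "bij (\<lambda>z. L z + g 0)" by (simp add: comp_def)
  then show ?thesis by (subst L(2))
qed

lemma plane_isometry_comp:
  "plane_isometry g \<Longrightarrow> plane_isometry h \<Longrightarrow> plane_isometry (g \<circ> h)"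
  by (simp add: plane_isometry_def)

lemma plane_isometry_funpow: "plane_isometry g \<Longrightarrow> plane_isometry (g ^^ i)"
  by (induction i) (auto simp: plane_isometry_def)

lemma is_square_isometry:
  assumes g: "plane_isometry g" and Q: "is_square s Q" shows "is_square s (g ` Q)"
proof -
  obtain L where L: "orthogonal_transformation L" "g = (\<lambda>z. L z + g 0)"
    using plane_isometry_affine[OF g] by blast
  have lin: "linear L" using L(1) by (simp add: orthogonal_transformation_def)
  obtain p u v where s: "s > 0" and n: "norm u = 1" "norm v = 1" "u \<bullet> v = 0"
    and Q': "Q = {p + x *\<^sub>R u + y *\<^sub>R v | x y. 0 \<le> x \<and> x \<le> s \<and> 0 \<le> y \<and> y \<le> s}"
    using Q unfolding is_square_def by blast
  have "g (p + x *\<^sub>R u + y *\<^sub>R v) = g p + x *\<^sub>R L u + y *\<^sub>R L v" for x y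
    by (subst (1 2) L(2)) (simp add: linear_add[OF lin] linear_cmul[OF lin])
  then have "g ` Q = {g p + x *\<^sub>R L u + y *\<^sub>R L v | x y. 0 \<le> x \<and> x \<le> s \<and> 0 \<le> y \<and> y \<le> s}"
    unfolding Q' by (fastforce simp: image_iff)
  moreover have "norm (L u) = 1" "norm (L v) = 1" "L u \<bullet> L v = 0"
    using n L(1) orthogonal_transformation_norm[OF L(1)] by (auto simp: orthogonal_transformation_def)
  ultimately show ?thesis using s unfolding is_square_def by blast
qed

text \<open>The frontier is characterised by distances alone.\<close>

lemma frontier_isometry:
  assumes g: "plane_isometry g" shows "frontier (g ` S) = g ` frontier S"
proof -
  have bij: "bij g" using g by (rule plane_isometry_bij)
  have d: "dist (g z) (g w) = dist z w" for z w using g by (simp add: plane_isometry_def)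
  have "g z \<in> frontier (g ` S) \<longleftrightarrow> z \<in> frontier S" for z
  proof -
    have "(\<exists>w\<in>g ` S. dist (g z) w < e) \<longleftrightarrow> (\<exists>w\<in>S. dist z w < e)" for e by (simp add: d)
    moreover have "(\<exists>w. w \<notin> g ` S \<and> dist (g z) w < e) \<longleftrightarrow> (\<exists>w. w \<notin> S \<and> dist z w < e)" for e
    proof
      assume "\<exists>w. w \<notin> g ` S \<and> dist (g z) w < e"
      then obtain w where w: "w \<notin> g ` S" "dist (g z) w < e" by blast
      obtain w' where "w = g w'" using bij_is_surj[OF bij] by (rule surjE)
      then show "\<exists>w. w \<notin> S \<and> dist z w < e" using w d by auto
    next
      assume "\<exists>w. w \<notin> S \<and> dist z w < e"
      then obtain w where "w \<notin> S" "dist z w < e" by blast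
      then have "g w \<notin> g ` S" "dist (g z) (g w) < e"
        using inj_image_mem_iff[OF bij_is_inj[OF bij]] d by auto
      then show "\<exists>w. w \<notin> g ` S \<and> dist (g z) w < e" by blast
    qed
    ultimately show ?thesis by (simp add: frontier_straddle)
  qed
  note mem = this
  show ?thesis
  proof (rule set_eqI)
    fix y obtain z where "y = g z" using bij_is_surj[OF bij] by (rule surjE)
    then show "y \<in> frontier (g ` S) \<longleftrightarrow> y \<in> g ` frontier S"
      using mem bij by (simp add: inj_image_mem_iff bij_is_inj)
  qed
qed

lemma orthonormal_plane:
  fixes c d v w :: real
  assumes "c\<^sup>2 + d\<^sup>2 = 1" "v\<^sup>2 + w\<^sup>2 = 1" "c * v + d * w = 0"
  obtains \<sigma> where "\<sigma>\<^sup>2 = 1" "v = - \<sigma> * d" "w = \<sigma> * c"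
proof
  have "(c * w - d * v)\<^sup>2 = (c\<^sup>2 + d\<^sup>2) * (v\<^sup>2 + w\<^sup>2) - (c * v + d * w)\<^sup>2" by algebra
  then show "(c * w - d * v)\<^sup>2 = 1" using assms by simp
  have "v * (c\<^sup>2 + d\<^sup>2) = - (c * w - d * v) * d + c * (c * v + d * w)" by algebra
  then show "v = - (c * w - d * v) * d" using assms by simp
  have "w * (c\<^sup>2 + d\<^sup>2) = (c * w - d * v) * c + d * (c * v + d * w)" by algebra
  then show "w = (c * w - d * v) * c" using assms by simp
qed

text \<open>The coordinates of a point in the frame of a square define an isometry that carries the square to
standard position, so that coverings need only be studied for \<open>[0, s]\<^sup>2\<close>.\<close>

lemma is_square_axis:
  assumes "is_square s S"
  obtains g where "plane_isometry g" "g ` S = axis_square s"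
proof -
  obtain p u v where s: "s > 0" and n: "norm u = 1" "norm v = 1" "u \<bullet> v = 0"
    and Q: "S = {p + x *\<^sub>R u + y *\<^sub>R v | x y. 0 \<le> x \<and> x \<le> s \<and> 0 \<le> y \<and> y \<le> s}"
    using assms unfolding is_square_def by blast
  define L where "L z = pt (z \<bullet> u) (z \<bullet> v)" for z :: "real^2"
  have n': "(u$1)\<^sup>2 + (u$2)\<^sup>2 = 1" "(v$1)\<^sup>2 + (v$2)\<^sup>2 = 1" "u$1 * v$1 + u$2 * v$2 = 0"
    using n by (auto simp: norm_plane inner_plane)
  \<comment> \<open>the columns of an orthogonal matrix are orthonormal because its rows are\<close>
  obtain \<sigma> where \<sigma>: "\<sigma>\<^sup>2 = 1" "v$1 = - \<sigma> * u$2" "v$2 = \<sigma> * u$1"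
    using orthonormal_plane[OF n'] by blast
  have "(v$1)\<^sup>2 = (u$2)\<^sup>2" "(v$2)\<^sup>2 = (u$1)\<^sup>2"
    unfolding \<sigma>(2,3) by (simp_all add: power_mult_distrib \<sigma>(1))
  moreover have "v$1 * v$2 = - (\<sigma>\<^sup>2 * (u$1 * u$2))"
    unfolding \<sigma>(2,3) by (simp add: power2_eq_square)
  ultimately have cols: "(u$1)\<^sup>2 + (v$1)\<^sup>2 = 1" "(u$2)\<^sup>2 + (v$2)\<^sup>2 = 1" "u$1 * u$2 + v$1 * v$2 = 0"
    using n'(1) \<sigma>(1) by auto
  have nL: "norm (L z) = norm z" for z
  proof -
    have "(z \<bullet> u)\<^sup>2 + (z \<bullet> v)\<^sup>2 = (z$1)\<^sup>2 * ((u$1)\<^sup>2 + (v$1)\<^sup>2) + (z$2)\<^sup>2 * ((u$2)\<^sup>2 + (v$2)\<^sup>2)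
        + 2 * z$1 * z$2 * (u$1 * u$2 + v$1 * v$2)"
      unfolding inner_plane by algebra
    then show ?thesis using cols by (simp add: L_def norm_plane)
  qed
  have Ld: "L z - L w = L (z - w)" for z w
    by (simp add: L_def pt_eq_iff inner_diff_left)
  define g where "g z = L (z - p)" for z
  have "plane_isometry g"
    unfolding plane_isometry_def dist_norm g_def Ld nL by simp
  moreover have "g ` S = axis_square s"
  proof -
    have uu: "u \<bullet> u = 1" "v \<bullet> v = 1" "v \<bullet> u = 0" using n by (auto simp: norm_eq_1 inner_commute)
    have "g (p + x *\<^sub>R u + y *\<^sub>R v) = pt x y" for x y
      by (simp add: g_def L_def pt_eq_iff inner_add_left uu n)
    then have "g ` S = {pt x y | x y. 0 \<le> x \<and> x \<le> s \<and> 0 \<le> y \<and> y \<le> s}"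
      unfolding Q by (fastforce simp: image_iff)
    also have "\<dots> = axis_square s"
      by (auto simp: axis_square_def mem_box_cart forall_2) (metis pt_components)
    finally show ?thesis .
  qed
  ultimately show ?thesis using that by blast
qed

section \<open>Squares in coordinates\<close>

text \<open>The unit square with edge directions \<open>(c, d)\<close> and \<open>(- d, c)\<close>, written as an intersection of two strips, so
that membership amounts to four linear inequalities.\<close>

definition frame_square :: "real \<Rightarrow> real \<Rightarrow> real \<Rightarrow> real \<Rightarrow> (real^2) set" where
  "frame_square c d a b = {z. a \<le> c * z$1 + d * z$2 \<and> c * z$1 + d * z$2 \<le> a + 1 \<and>
                              b \<le> c * z$2 - d * z$1 \<and> c * z$2 - d * z$1 \<le> b + 1}"

lemma frame_square_unit:
  assumes "c\<^sup>2 + d\<^sup>2 = 1" shows "is_square 1 (frame_square c d a b)"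
proof -
  let ?p = "pt (c * a - d * b) (d * a + c * b)" and ?u = "pt c d" and ?v = "pt (- d) c"
  have "frame_square c d a b = {?p + x *\<^sub>R ?u + y *\<^sub>R ?v | x y. 0 \<le> x \<and> x \<le> 1 \<and> 0 \<le> y \<and> y \<le> 1}"
    (is "?A = ?B")
  proof (intro equalityI subsetI)
    fix z assume z: "z \<in> ?A"
    let ?x = "c * z$1 + d * z$2 - a" and ?y = "c * z$2 - d * z$1 - b"
    have "z$1 = c * a - d * b + ?x * c - ?y * d" "z$2 = d * a + c * b + ?x * d + ?y * c"
      using assms by algebra+
    then have "z = ?p + ?x *\<^sub>R ?u + ?y *\<^sub>R ?v" by (simp add: pt_eq_iff)
    moreover have "0 \<le> ?x" "?x \<le> 1" "0 \<le> ?y" "?y \<le> 1" using z by (auto simp: frame_square_def)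
    ultimately show "z \<in> ?B" by blast
  next
    fix z assume "z \<in> ?B"
    then obtain x y where xy: "0 \<le> x" "x \<le> 1" "0 \<le> y" "y \<le> 1" and z: "z = ?p + x *\<^sub>R ?u + y *\<^sub>R ?v"
      by blast
    have "c * z$1 + d * z$2 = a + x" "c * z$2 - d * z$1 = b + y"
      unfolding z using assms by (simp, algebra)+
    then show "z \<in> ?A" using xy by (auto simp: frame_square_def)
  qed
  then show ?thesis unfolding is_square_def using assms
    by (intro conjI exI[of _ ?p] exI[of _ ?u] exI[of _ ?v])
       (auto simp: norm_plane inner_plane add.commute)
qed

text \<open>Both direction cosines can be taken nonnegative, since a quarter turn of the frame only relabels the
edges. With this choice no signs have to be distinguished when a square is placed at a corner.\<close>

lemma unit_square_frame:
  assumes "is_square 1 Q"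
  obtains c d a b where "0 \<le> c" "0 \<le> d" "c\<^sup>2 + d\<^sup>2 = 1" "Q = frame_square c d a b"
proof -
  obtain p u v where n: "norm u = 1" "norm v = 1" "u \<bullet> v = 0"
    and Q: "Q = {p + x *\<^sub>R u + y *\<^sub>R v | x y. 0 \<le> x \<and> x \<le> 1 \<and> 0 \<le> y \<and> y \<le> 1}"
    using assms unfolding is_square_def by blast
  define c d where "c = u$1" and "d = u$2"
  have cd: "c\<^sup>2 + d\<^sup>2 = 1" and vv: "(v$1)\<^sup>2 + (v$2)\<^sup>2 = 1" and uv: "c * v$1 + d * v$2 = 0"
    using n by (auto simp: norm_plane inner_plane c_def d_def)
  \<comment> \<open>the two edge directions form a right-handed or a left-handed frame\<close>
  obtain \<sigma> where "\<sigma>\<^sup>2 = 1" and v: "v$1 = - \<sigma> * d" "v$2 = \<sigma> * c"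
    using orthonormal_plane[OF cd vv uv] by blast
  then have \<sigma>: "\<sigma> = 1 \<or> \<sigma> = -1" by (simp add: power2_eq_1_iff)
  define a where "a = c * p$1 + d * p$2"
  define b where "b = c * p$2 - d * p$1 + (if \<sigma> = 1 then 0 else -1)"
  have "Q = frame_square c d a b"
  proof (intro equalityI subsetI)
    fix z assume "z \<in> Q"
    then obtain x y where xy: "0 \<le> x" "x \<le> 1" "0 \<le> y" "y \<le> 1" and z: "z = p + x *\<^sub>R u + y *\<^sub>R v"
      unfolding Q by blast
    have z': "z$1 = p$1 + x * c - y * \<sigma> * d" "z$2 = p$2 + x * d + y * \<sigma> * c"
      by (auto simp: z c_def d_def v[unfolded c_def d_def])
    have "c * z$1 + d * z$2 = c * p$1 + d * p$2 + x" "c * z$2 - d * z$1 = c * p$2 - d * p$1 + \<sigma> * y"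
      unfolding z' using cd by algebra+
    then show "z \<in> frame_square c d a b" using \<sigma> xy by (auto simp: frame_square_def a_def b_def)
  next
    fix z assume z: "z \<in> frame_square c d a b"
    define x where "x = c * z$1 + d * z$2 - (c * p$1 + d * p$2)"
    define y where "y = \<sigma> * (c * z$2 - d * z$1 - (c * p$2 - d * p$1))"
    have "0 \<le> x" "x \<le> 1" "0 \<le> y" "y \<le> 1"
      using z \<sigma> by (auto simp: frame_square_def a_def b_def x_def y_def)
    moreover have "z$1 = p$1 + x * c - y * \<sigma> * d" "z$2 = p$2 + x * d + y * \<sigma> * c"
      unfolding x_def y_def using cd \<open>\<sigma>\<^sup>2 = 1\<close> by algebra+
    then have "z = p + x *\<^sub>R u + y *\<^sub>R v"
      by (simp add: pt_eq_iff v) (simp add: c_def d_def)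
    ultimately show "z \<in> Q" unfolding Q by blast
  qed
  \<comment> \<open>turning the frame by quarter turns makes both direction cosines nonnegative\<close>
  moreover have "frame_square c d a b = frame_square d (- c) (- b - 1) a"
    by (auto simp: frame_square_def)
  moreover have "frame_square c d a b = frame_square (- c) (- d) (- a - 1) (- b - 1)"
    by (auto simp: frame_square_def)
  moreover have "frame_square c d a b = frame_square (- d) c b (- a - 1)"
    by (auto simp: frame_square_def)
  ultimately have Qs: "Q = frame_square c d a b" "Q = frame_square d (- c) (- b - 1) a"
    "Q = frame_square (- c) (- d) (- a - 1) (- b - 1)" "Q = frame_square (- d) c b (- a - 1)"
    by metis+
  consider "0 \<le> c" "0 \<le> d" | "c \<le> 0" "0 \<le> d" | "c \<le> 0" "d \<le> 0" | "0 \<le> c" "d \<le> 0" by linarith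
  then show ?thesis
  proof cases
    case 1 show ?thesis by (rule that[OF _ _ _ Qs(1)]) (use 1 cd in auto)
  next
    case 2 show ?thesis by (rule that[OF _ _ _ Qs(2)]) (use 2 cd in auto)
  next
    case 3 show ?thesis by (rule that[OF _ _ _ Qs(3)]) (use 3 cd in auto)
  next
    case 4 show ?thesis by (rule that[OF _ _ _ Qs(4)]) (use 4 cd in auto)
  qed
qed

lemma unit_square_convex: assumes "is_square 1 Q" shows "convex Q"
proof -
  obtain c d a b where Q: "Q = frame_square c d a b" using unit_square_frame[OF assms] by metis
  have "Q = {z. a \<le> pt c d \<bullet> z} \<inter> {z. pt c d \<bullet> z \<le> a + 1} \<inter>
      {z. b \<le> pt (- d) c \<bullet> z} \<inter> {z. pt (- d) c \<bullet> z \<le> b + 1}"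
    by (auto simp: Q frame_square_def inner_plane)
  then show ?thesis
    by (metis convex_Int convex_halfspace_le convex_halfspace_ge)
qed

lemma unit_square_closed: assumes "is_square 1 Q" shows "closed Q"
proof -
  obtain c d a b where Q: "Q = frame_square c d a b" using unit_square_frame[OF assms] by metis
  show ?thesis unfolding Q frame_square_def
    by (intro closed_Collect_conj closed_Collect_le continuous_intros)
qed

lemma unit_square_diameter:
  assumes "is_square 1 Q" "z \<in> Q" "w \<in> Q" shows "dist z w \<le> sqrt 2"
proof -
  obtain c d a b where cd: "c\<^sup>2 + d\<^sup>2 = 1" and Q: "Q = frame_square c d a b"
    using unit_square_frame[OF assms(1)] by metis
  define X Y where "X = c * z$1 + d * z$2 - (c * w$1 + d * w$2)"
    and "Y = c * z$2 - d * z$1 - (c * w$2 - d * w$1)"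
  have "\<bar>X\<bar> \<le> 1" "\<bar>Y\<bar> \<le> 1" using assms(2,3) by (auto simp: Q frame_square_def X_def Y_def)
  then have "X\<^sup>2 + Y\<^sup>2 \<le> 2" using abs_square_le_1 by (metis add_mono one_add_one)
  moreover have "(z$1 - w$1)\<^sup>2 + (z$2 - w$2)\<^sup>2 = X\<^sup>2 + Y\<^sup>2" using cd unfolding X_def Y_def by algebra
  ultimately show ?thesis by (simp add: dist_plane)
qed

section \<open>Reach of a unit square along the two sides at a corner\<close>

text \<open>How far a unit square that contains a corner can reach along one side if it reaches \<open>u \<ge> 1\<close> along the
other one. In the extreme position the chord of length \<open>u\<close> joins two opposite edges of the square, which
fixes the direction of the square, and the other chord ends on a third edge.\<close>

definition short_reach :: "real \<Rightarrow> real" where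
  "short_reach u = u - u * sqrt (u\<^sup>2 - 1)"

text \<open>The pairs of lengths that a unit square can cover along two perpendicular rays from a point of the square.
The three alternatives are the chords of length at most one, and those where the first or the second
chord is the long one.\<close>

definition corner_reach :: "(real \<times> real) set" where
  "corner_reach = {(u, v). 0 \<le> u \<and> 0 \<le> v \<and>
     ((u \<le> 1 \<and> v \<le> 1) \<or> (1 \<le> u \<and> v \<le> short_reach u) \<or> (1 \<le> v \<and> u \<le> short_reach v))}"

lemma sqrt2_bounds: "141421 / 100000 < sqrt 2" "sqrt 2 < 141422 / 100000"
proof -
  show "141421 / 100000 < sqrt 2" by (rule real_less_rsqrt) (simp add: power2_eq_square)
  show "sqrt 2 < 141422 / 100000" by (rule real_less_lsqrt) (simp_all add: power2_eq_square)
qed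

lemma short_reach_one [simp]: "short_reach 1 = 1"
  by (simp add: short_reach_def)

lemma short_reach_sqrt2 [simp]: "short_reach (sqrt 2) = 0"
  by (simp add: short_reach_def)

lemma corner_reach_nonneg: "(u, v) \<in> corner_reach \<Longrightarrow> 0 \<le> u" "(u, v) \<in> corner_reach \<Longrightarrow> 0 \<le> v"
  by (auto simp: corner_reach_def)

lemma corner_reach_swap: "(u, v) \<in> corner_reach \<longleftrightarrow> (v, u) \<in> corner_reach"
  by (auto simp: corner_reach_def)

lemma short_reach_nonneg_bound: assumes "1 \<le> u" "0 \<le> short_reach u" shows "sqrt (u\<^sup>2 - 1) \<le> 1" "u \<le> sqrt 2"
proof -
  have "u * sqrt (u\<^sup>2 - 1) \<le> u * 1" using assms(2) by (simp add: short_reach_def)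
  then show *: "sqrt (u\<^sup>2 - 1) \<le> 1" using assms(1) by (simp add: mult_le_cancel_left)
  then have "u\<^sup>2 \<le> 2" by simp
  then show "u \<le> sqrt 2" using assms(1) real_le_rsqrt by blast
qed

text \<open>Put \<open>p = sqrt (u\<^sup>2 - 1)\<close>, \<open>q = sqrt (v\<^sup>2 - 1)\<close> and \<open>w = p + q\<close>. The difference quotient of \<open>u * p\<close> is
\<open>((u + v)\<^sup>2 + w\<^sup>2) / (2 * w)\<close>, and this is at least \<open>w + 2 / w \<ge> 2 * sqrt 2\<close>.\<close>

lemma short_reach_slope:
  assumes "1 \<le> u" "u \<le> v"
  shows "short_reach v \<le> short_reach u - (2 * sqrt 2 - 1) * (v - u)"
proof -
  define p q where "p = sqrt (u\<^sup>2 - 1)" and "q = sqrt (v\<^sup>2 - 1)"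
  have u: "1 \<le> u\<^sup>2" using assms by simp
  have v: "u\<^sup>2 \<le> v\<^sup>2" using assms by (simp add: power_mono)
  have pq: "0 \<le> p" "p \<le> q" "p\<^sup>2 = u\<^sup>2 - 1" "q\<^sup>2 = v\<^sup>2 - 1" using u v by (auto simp: p_def q_def)
  have *: "2 * sqrt 2 * (v - u) \<le> v * q - u * p"
  proof (cases "u = v")
    case True then show ?thesis using pq by (simp add: p_def q_def)
  next
    case False
    then have vu: "u < v" using assms by simp
    then have "u\<^sup>2 < v\<^sup>2" using assms by (simp add: power_strict_mono)
    then have "p < q" by (simp add: p_def q_def)
    define w where "w = p + q"
    have w: "w > 0" using \<open>p < q\<close> pq by (simp add: w_def)
    \<comment> \<open>hyperbolic Cauchy inequality for the unit vectors \<open>(u, p)\<close>, \<open>(v, q)\<close>\<close>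
    have "(p * q + 1)\<^sup>2 \<le> (u * v)\<^sup>2"
    proof -
      have "(u * v)\<^sup>2 = (p\<^sup>2 + 1) * (q\<^sup>2 + 1)" using pq by (simp add: power_mult_distrib)
      also have "\<dots> = (p * q + 1)\<^sup>2 + (q - p)\<^sup>2" by algebra
      finally show ?thesis by simp
    qed
    then have "p * q + 1 \<le> u * v" using assms pq by (simp add: power2_le_iff_abs_le)
    then have "w\<^sup>2 + 4 \<le> (u + v)\<^sup>2" using pq by (simp add: w_def power2_sum)
    moreover have "2 * (v * q - u * p) * w = (v - u) * ((u + v)\<^sup>2 + w\<^sup>2)"
      using pq(3,4) unfolding w_def by algebra
    moreover have "4 * sqrt 2 * w \<le> 2 * w\<^sup>2 + 4"
      using zero_le_power2[of "w - sqrt 2"] by (simp add: power2_diff algebra_simps)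
    moreover have "(v - u) * (4 * sqrt 2 * w) \<le> (v - u) * ((u + v)\<^sup>2 + w\<^sup>2)"
      using vu calculation by (intro mult_left_mono) auto
    ultimately have "(v - u) * (4 * sqrt 2 * w) \<le> 2 * (v * q - u * p) * w" by linarith
    then have "(2 * sqrt 2 * (v - u)) * (2 * w) \<le> (v * q - u * p) * (2 * w)" by (simp add: algebra_simps)
    then show ?thesis using w by simp
  qed
  then show ?thesis by (simp add: short_reach_def p_def q_def algebra_simps)
qed

lemma short_reach_strict_antimono:
  assumes "1 \<le> u" "u < v" shows "short_reach v < short_reach u"
proof -
  have "0 < (2 * sqrt 2 - 1) * (v - u)" using assms sqrt2_bounds by (intro mult_pos_pos) auto
  then show ?thesis using short_reach_slope[of u v] assms by linarith
qed

lemma short_reach_antimono: "1 \<le> u \<Longrightarrow> u \<le> v \<Longrightarrow> short_reach v \<le> short_reach u"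
  using short_reach_strict_antimono[of u v] by (cases "u = v") auto

text \<open>Beyond length one, lengthening one chord shortens the other by more than is gained.\<close>

lemma corner_reach_sum: assumes "(u, v) \<in> corner_reach"
  shows "u + v \<le> 2" "u + v = 2 \<Longrightarrow> u = 1 \<and> v = 1"
proof -
  have *: "x + y < 2" if "1 < x" "y \<le> short_reach x" for x y
  proof -
    define m where "m = (2 * sqrt 2 - 1) * (x - 1)"
    have "1 * (x - 1) < (2 * sqrt 2 - 1) * (x - 1)"
      using that sqrt2_bounds by (intro mult_strict_right_mono) auto
    then have "x - 1 < m" by (simp add: m_def)
    moreover have "short_reach x \<le> 1 - m"
      using short_reach_slope[of 1 x] that by (simp add: m_def)
    ultimately show ?thesis using that(2) by linarith
  qed
  have "u + v < 2 \<or> (u \<le> 1 \<and> v \<le> 1)"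
    using assms *[of u v] *[of v u] unfolding corner_reach_def
    by (cases "u = 1"; cases "v = 1") auto
  then show "u + v \<le> 2" "u + v = 2 \<Longrightarrow> u = 1 \<and> v = 1" by auto
qed

lemma corner_reach_long: assumes "(u, v) \<in> corner_reach" "1 < u" shows "v \<le> short_reach u"
proof -
  have "v \<le> 1" using corner_reach_sum(1)[OF assms(1)] assms(2) by linarith
  then show ?thesis using assms unfolding corner_reach_def by auto
qed

lemma corner_reach_le_sqrt2: assumes "(u, v) \<in> corner_reach" shows "u \<le> sqrt 2" "v \<le> sqrt 2"
proof -
  have *: "x \<le> sqrt 2 \<and> y \<le> sqrt 2" if "1 \<le> x" "0 \<le> y" "y \<le> short_reach x" for x y
  proof -
    have "0 \<le> x * sqrt (x\<^sup>2 - 1)" using that by (intro mult_nonneg_nonneg) auto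
    then have "y \<le> x" using that(3) unfolding short_reach_def by linarith
    moreover have "x \<le> sqrt 2" using short_reach_nonneg_bound(2)[of x] that by linarith
    ultimately show ?thesis by simp
  qed
  have "u \<le> 1 \<and> v \<le> 1 \<or> (1 \<le> u \<and> 0 \<le> v \<and> v \<le> short_reach u) \<or> (1 \<le> v \<and> 0 \<le> u \<and> u \<le> short_reach v)"
    using assms by (auto simp: corner_reach_def)
  then have "u \<le> sqrt 2 \<and> v \<le> sqrt 2" using *[of u v] *[of v u] sqrt2_bounds by (elim disjE) auto
  then show "u \<le> sqrt 2" "v \<le> sqrt 2" by auto
qed

text \<open>Here \<open>(c, d)\<close> is the direction of the frame relative to the chord of length \<open>u\<close>. The hypotheses say that this
chord fits into one strip, and that both chords together fit into the other one. The first condition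
confines \<open>(c, d)\<close> to an arc of the unit circle that starts at \<open>(0, 1)\<close>. If \<open>v > short_reach u\<close>, the second
one fails at both ends of the arc and, by concavity, also in between.\<close>

lemma direction_bound:
  fixes c d u v :: real
  assumes cd: "0 \<le> c" "0 \<le> d" "c\<^sup>2 + d\<^sup>2 = 1" and u: "1 < u" "c * u \<le> 1"
    and v: "0 \<le> v" "d * u + c * v \<le> 1"
  shows "v \<le> short_reach u" "v = short_reach u \<Longrightarrow> c = 1 / u \<and> d = sqrt (u\<^sup>2 - 1) / u"
proof -
  define e where "e = sqrt (u\<^sup>2 - 1) / u"
  have u2: "1 < u\<^sup>2" using u by (simp add: one_less_power)
  have e0: "0 < e" using u u2 by (simp add: e_def)
  have e2: "e\<^sup>2 = 1 - 1 / u\<^sup>2" using u u2 by (simp add: e_def power_divide field_simps)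
  have "e\<^sup>2 < 1" using u u2 by (simp add: e2)
  then have e1: "e < 1" using e0 by (metis less_eq_real_def one_power2 power2_less_imp_less zero_le_one)
  \<comment> \<open>the parameter of the chord point with first coordinate \<open>c\<close>\<close>
  define l where "l = c * u"
  have l: "0 \<le> l" "l \<le> 1" using cd u by (auto simp: l_def)
  have c: "c = l / u" using u by (simp add: l_def)
  \<comment> \<open>the unit circle is concave: its point \<open>(c, d)\<close> lies above the chord from \<open>(0, 1)\<close> to \<open>(1/u, e)\<close>\<close>
  have "(l * e + (1 - l))\<^sup>2 \<le> d\<^sup>2"
  proof -
    have "d\<^sup>2 - (l * e + (1 - l))\<^sup>2 = 1 - l\<^sup>2 / u\<^sup>2 - (l * e + (1 - l))\<^sup>2"
      using cd(3) c by (simp add: power_divide algebra_simps)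
    also have "\<dots> = 2 * l * (1 - l) * (1 - e)"
    proof -
      have "l\<^sup>2 / u\<^sup>2 = l\<^sup>2 * (1 - e\<^sup>2)" by (simp add: e2)
      then show ?thesis by (simp add: power2_eq_square algebra_simps)
    qed
    also have "\<dots> \<ge> 0" using l e1 by simp
    finally show ?thesis by simp
  qed
  then have "l * e + (1 - l) \<le> d" by (rule power2_le_imp_le) (rule cd(2))
  then have "(l * e + (1 - l)) * u \<le> d * u" using u by (simp add: mult_right_mono)
  then have *: "l * (e * u + v / u) + (1 - l) * u \<le> 1"
    using v c by (simp add: algebra_simps)
  have l0: "l > 0"
    using * l u by (cases "l = 0") auto
  have eu: "e * u = sqrt (u\<^sup>2 - 1)" using u by (simp add: e_def)
  show "v \<le> short_reach u"
  proof (rule ccontr)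
    assume "\<not> ?thesis"
    then have "v / u > 1 - sqrt (u\<^sup>2 - 1)" using u by (simp add: short_reach_def field_simps)
    then have "l * (e * u + v / u) > l * 1" using l0 eu by (intro mult_strict_left_mono) auto
    moreover have "(1 - l) * u \<ge> 1 - l" using l u mult_left_mono[of 1 u "1 - l"] by simp
    ultimately show False using * by simp
  qed
  assume "v = short_reach u"
  then have "v / u = 1 - sqrt (u\<^sup>2 - 1)" using u by (simp add: short_reach_def field_simps)
  then have "(1 - l) * (u - 1) \<le> 0" using * eu by (simp add: algebra_simps)
  then have "l = 1" using l u by (simp add: mult_le_0_iff)
  then have "c = 1 / u" using c by simp
  moreover have "d\<^sup>2 = e\<^sup>2" using cd(3) \<open>c = 1 / u\<close> by (simp add: e2 power_divide)
  then have "d = e" using cd(2) e0 by (simp add: power2_eq_iff_nonneg)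
  ultimately show "c = 1 / u \<and> d = sqrt (u\<^sup>2 - 1) / u" by (simp add: e_def)
qed

text \<open>The six bounds with \<open>a\<close> and \<open>b\<close> express that the corner and the ends of both chords lie in the two strips;
the last three, obtained by eliminating \<open>a\<close> and \<open>b\<close>, depend on the direction only.\<close>

lemma unit_square_corner:
  assumes "is_square 1 Q" and uv: "0 \<le> u" "0 \<le> v"
    and mem: "pt 0 0 \<in> Q" "pt u 0 \<in> Q" "pt 0 v \<in> Q"
  obtains c d a b where "0 \<le> c" "0 \<le> d" "c\<^sup>2 + d\<^sup>2 = 1" "Q = frame_square c d a b"
    "a \<le> 0" "b \<le> - d * u" "c * u \<le> a + 1" "d * v \<le> a + 1" "c * v \<le> b + 1" "0 \<le> b + 1"
    "c * u \<le> 1" "d * v \<le> 1" "d * u + c * v \<le> 1"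
proof -
  obtain c d a b where *: "0 \<le> c" "0 \<le> d" "c\<^sup>2 + d\<^sup>2 = 1" "Q = frame_square c d a b"
    using unit_square_frame[OF assms(1)] by metis
  show ?thesis by (rule that[OF *]) (use mem in \<open>auto simp: *(4) frame_square_def\<close>)
qed

lemma unit_square_corner_reach:
  assumes "is_square 1 Q" and uv: "0 \<le> u" "0 \<le> v"
    and mem: "pt 0 0 \<in> Q" "pt u 0 \<in> Q" "pt 0 v \<in> Q"
  shows "(u, v) \<in> corner_reach"
proof -
  obtain c d a b where cd: "0 \<le> c" "0 \<le> d" "c\<^sup>2 + d\<^sup>2 = 1"
    and ineq: "c * u \<le> 1" "d * v \<le> 1" "d * u + c * v \<le> 1"
    using unit_square_corner[OF assms] by metis
  show ?thesis
  proof (cases "u \<le> 1 \<and> v \<le> 1")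
    case True then show ?thesis using uv by (simp add: corner_reach_def)
  next
    case False
    then consider "1 < u" | "1 < v" by linarith
    then show ?thesis
    proof cases
      case 1
      then show ?thesis using direction_bound(1)[OF cd _ ineq(1) uv(2)] ineq uv
        by (simp add: corner_reach_def)
    next
      case 2
      then show ?thesis using direction_bound(1)[of d c v u] cd ineq uv
        by (simp add: corner_reach_def add.commute)
    qed
  qed
qed

text \<open>Equality in the bound for the direction fixes the direction, and both strips are then filled
completely, which fixes the position.\<close>

lemma unit_square_corner_unique:
  assumes "is_square 1 Q" and u: "1 < u" "0 \<le> short_reach u"
    and mem: "pt 0 0 \<in> Q" "pt u 0 \<in> Q" "pt 0 (short_reach u) \<in> Q"
  shows "Q = frame_square (1 / u) (sqrt (u\<^sup>2 - 1) / u) 0 (- sqrt (u\<^sup>2 - 1))"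
proof -
  have u0: "0 \<le> u" using u(1) by simp
  obtain c d a b where cd: "0 \<le> c" "0 \<le> d" "c\<^sup>2 + d\<^sup>2 = 1" "Q = frame_square c d a b"
    and ineq: "a \<le> 0" "b \<le> - d * u" "c * u \<le> a + 1" "d * short_reach u \<le> a + 1"
      "c * short_reach u \<le> b + 1" "0 \<le> b + 1"
      "c * u \<le> 1" "d * short_reach u \<le> 1" "d * u + c * short_reach u \<le> 1"
    using unit_square_corner[OF assms(1) u0 u(2) mem] by blast
  have c: "c = 1 / u" and d: "d = sqrt (u\<^sup>2 - 1) / u"
    using direction_bound(2)[OF cd(1-3) u(1) ineq(7) u(2) ineq(9)] by auto
  have "a = 0" using ineq(1,3) c u by simp
  moreover have "c * short_reach u = 1 - sqrt (u\<^sup>2 - 1)" using u by (simp add: c short_reach_def field_simps)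
  then have "b = - sqrt (u\<^sup>2 - 1)" using ineq(2,5) u by (simp add: d)
  ultimately show ?thesis using cd(4) c d by simp
qed

lemma unit_square_axis_unique:
  assumes "is_square 1 Q" and mem: "pt 0 0 \<in> Q" "pt 1 0 \<in> Q" "pt 0 1 \<in> Q"
  shows "Q = axis_square 1"
proof -
  obtain c d a b where cd: "0 \<le> c" "0 \<le> d" "c\<^sup>2 + d\<^sup>2 = 1" "Q = frame_square c d a b"
    and ineq': "a \<le> 0" "b \<le> - d * 1" "c * 1 \<le> a + 1" "d * 1 \<le> a + 1" "c * 1 \<le> b + 1" "0 \<le> b + 1"
      "c * 1 \<le> 1" "d * 1 \<le> 1" "d * 1 + c * 1 \<le> 1"
    using unit_square_corner[OF assms(1) zero_le_one zero_le_one mem] by blast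
  then have ineq: "a \<le> 0" "b \<le> - d" "c \<le> a + 1" "d \<le> a + 1" "c \<le> b + 1" "0 \<le> b + 1" "d + c \<le> 1"
    by simp_all
  have "(c + d)\<^sup>2 \<le> 1" using ineq cd by (simp add: power_le_one add.commute)
  then have "c * d \<le> 0" using cd(3) by (simp add: power2_sum)
  moreover have "0 \<le> c * d" using cd by simp
  ultimately have "c * d = 0" by linarith
  then have "c = 0 \<or> d = 0" by simp
  then show ?thesis
  proof
    assume "c = 0"
    then have "d = 1" using cd by (simp add: power2_eq_1_iff)
    then have "a = 0" "b = -1" using ineq \<open>c = 0\<close> by auto
    then show ?thesis using \<open>c = 0\<close> \<open>d = 1\<close> cd(4)
      by (auto simp: frame_square_def axis_square_def mem_box_cart forall_2)
  next
    assume "d = 0"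
    then have "c = 1" using cd by (simp add: power2_eq_1_iff)
    then have "a = 0" "b = 0" using ineq \<open>d = 0\<close> by auto
    then show ?thesis using \<open>d = 0\<close> \<open>c = 1\<close> cd(4)
      by (auto simp: frame_square_def axis_square_def mem_box_cart forall_2)
  qed
qed

lemma plane_isometry_swap: "plane_isometry (\<lambda>z. pt (z$2) (z$1))"
  by (simp add: plane_isometry_def dist_plane add.commute)

lemma corner_reach_attained:
  assumes "(u, v) \<in> corner_reach"
  obtains Q where "is_square 1 Q" "pt 0 0 \<in> Q" "pt u 0 \<in> Q" "pt 0 v \<in> Q"
proof -
  have long: "\<exists>Q. is_square 1 Q \<and> pt 0 0 \<in> Q \<and> pt x 0 \<in> Q \<and> pt 0 y \<in> Q"
    if "1 \<le> x" "0 \<le> y" "y \<le> short_reach x" for x y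
  proof (intro exI conjI)
    define e where "e = sqrt (x\<^sup>2 - 1)"
    let ?Q = "frame_square (1 / x) (e / x) 0 (- e)"
    have x2: "1 \<le> x\<^sup>2" using that by simp
    then have e: "0 \<le> e" "e\<^sup>2 = x\<^sup>2 - 1" by (auto simp: e_def)
    have e1: "e \<le> 1" using short_reach_nonneg_bound(1)[of x] that by (simp add: e_def)
    show "is_square 1 ?Q"
      by (rule frame_square_unit) (use that e x2 in \<open>simp add: power_divide field_simps\<close>)
    show "pt 0 0 \<in> ?Q" using e e1 by (simp add: frame_square_def)
    show "pt x 0 \<in> ?Q" using that e e1 by (simp add: frame_square_def)
    have "y \<le> x * (1 - e)" using that by (simp add: short_reach_def e_def algebra_simps)
    then have yx: "y / x \<le> 1 - e" using that by (simp add: field_simps)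
    then have "y / x \<le> 1" using e by linarith
    then have "e * (y / x) \<le> 1 * 1" using e e1 that by (intro mult_mono) auto
    then have "e * y / x \<le> 1" "0 \<le> e * y / x" using that e by simp_all
    moreover have "0 \<le> y / x" using that by simp
    ultimately show "pt 0 y \<in> ?Q" using e yx by (simp only: frame_square_def) simp
  qed
  have "\<exists>Q. is_square 1 Q \<and> pt 0 0 \<in> Q \<and> pt u 0 \<in> Q \<and> pt 0 v \<in> Q"
  proof -
    consider "0 \<le> u" "0 \<le> v" "u \<le> 1" "v \<le> 1" | "1 \<le> u" "0 \<le> v" "v \<le> short_reach u" | "1 \<le> v" "0 \<le> u" "u \<le> short_reach v"
      using assms unfolding corner_reach_def by auto
    then show ?thesis
    proof cases
      case 1
      have "is_square 1 (frame_square 1 0 0 0)" by (rule frame_square_unit) simp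
      moreover have "pt 0 0 \<in> frame_square 1 0 0 0" "pt u 0 \<in> frame_square 1 0 0 0" "pt 0 v \<in> frame_square 1 0 0 0"
        using 1 by (simp_all add: frame_square_def)
      ultimately show ?thesis by blast
    next
      case 2 then show ?thesis by (rule long)
    next
      case 3
      then obtain Q where Q: "is_square 1 Q" "pt 0 0 \<in> Q" "pt v 0 \<in> Q" "pt 0 u \<in> Q" using long by blast
      let ?h = "\<lambda>z::real^2. pt (z$2) (z$1)"
      have "is_square 1 (?h ` Q)" using is_square_isometry[OF plane_isometry_swap Q(1)] .
      moreover have "pt 0 0 \<in> ?h ` Q" "pt u 0 \<in> ?h ` Q" "pt 0 v \<in> ?h ` Q"
        using imageI[OF Q(2), of ?h] imageI[OF Q(4), of ?h] imageI[OF Q(3), of ?h] by simp_all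
      ultimately show ?thesis by blast
    qed
  qed
  then show ?thesis using that by blast
qed

lemma compact_corner_reach: "compact corner_reach"
proof -
  have eq: "corner_reach = {x. 0 \<le> fst x \<and> 0 \<le> snd x \<and> ((fst x \<le> 1 \<and> snd x \<le> 1) \<or>
     (1 \<le> fst x \<and> snd x \<le> short_reach (fst x)) \<or> (1 \<le> snd x \<and> fst x \<le> short_reach (snd x)))}"
    by (auto simp: corner_reach_def)
  have "closed corner_reach"
    unfolding eq short_reach_def
    by (intro closed_Collect_conj closed_Collect_disj closed_Collect_le continuous_intros)
  moreover have "corner_reach \<subseteq> {0..sqrt 2} \<times> {0..sqrt 2}"
    using corner_reach_le_sqrt2 corner_reach_nonneg by auto
  then have "bounded corner_reach"
    using bounded_subset[OF compact_imp_bounded[OF compact_Times[OF compact_Icc compact_Icc]]] by blast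
  ultimately show ?thesis by (simp add: compact_eq_bounded_closed)
qed

section \<open>The boundary of the square, side by side\<close>

text \<open>The quarter turn about the centre of \<open>[0, s]\<^sup>2\<close>.\<close>

definition turn :: "real \<Rightarrow> real^2 \<Rightarrow> real^2" where
  "turn s z = pt (s - z$2) (z$1)"

text \<open>The point at distance \<open>t\<close> from corner \<open>i\<close> on side \<open>i\<close>, the boundary being traversed counterclockwise. Corners
and sides are numbered modulo four, side \<open>i\<close> runs from corner \<open>i\<close> to corner \<open>i + 1\<close>, and the side that
ends at corner \<open>i\<close> is written \<open>i + 3\<close>. Since the points are iterates of \<open>turn\<close>, a fact about one corner
transfers to all of them.\<close>

definition side_pt :: "real \<Rightarrow> nat \<Rightarrow> real \<Rightarrow> real^2" where
  "side_pt s i t = (turn s ^^ i) (pt t 0)"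

lemma plane_isometry_turn: "plane_isometry (turn s)"
  by (simp add: plane_isometry_def dist_plane turn_def power2_commute add.commute)

lemma turn4: "(turn s ^^ (4 * k)) z = z"
proof -
  have "(turn s ^^ 4) = id" by (auto simp: fun_eq_iff turn_def eval_nat_numeral pt_eq_iff)
  then show ?thesis by (simp add: funpow_mult[symmetric])
qed

lemma turn_pow_axis_square: "(turn s ^^ i) ` axis_square s = axis_square s"
proof -
  have "turn s ` axis_square s = axis_square s"
  proof
    show "turn s ` axis_square s \<subseteq> axis_square s"
      by (auto simp: turn_def axis_square_def mem_box_cart forall_2)
    show "axis_square s \<subseteq> turn s ` axis_square s"
    proof
      fix z assume z: "z \<in> axis_square s"
      have "z = turn s (pt (z$2) (s - z$1))" by (simp add: turn_def pt_eq_iff)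
      moreover have "pt (z$2) (s - z$1) \<in> axis_square s"
        using z by (auto simp: axis_square_def mem_box_cart forall_2)
      ultimately show "z \<in> turn s ` axis_square s" by blast
    qed
  qed
  note turn = this
  show ?thesis
  proof (induction i)
    case (Suc i)
    have "(turn s ^^ Suc i) ` axis_square s = turn s ` (turn s ^^ i) ` axis_square s"
      by (simp only: funpow.simps image_comp)
    then show ?case by (simp only: Suc turn)
  qed simp
qed

lemma side_pt_add: "(turn s ^^ k) (side_pt s i t) = side_pt s (k + i) t"
  by (simp add: side_pt_def funpow_add)

lemma side_pt_period: "side_pt s (4 * k + i) t = side_pt s i t"
  by (simp add: side_pt_add[symmetric] turn4)

lemma side_pt_plus4 [simp]: "side_pt s (i + 4) t = side_pt s i t" "side_pt s (4 + i) t = side_pt s i t"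
  using side_pt_period[of s 1 i t] by (simp_all add: add.commute)

lemma side_pt_mod4: "side_pt s (i mod 4) t = side_pt s i t"
  using side_pt_period[of s "i div 4" "i mod 4" t] by simp

lemma side_pt_eqs: "side_pt s 0 t = pt t 0" "side_pt s (Suc 0) t = pt s t"
  "side_pt s 2 t = pt (s - t) s" "side_pt s 3 t = pt 0 (s - t)"
  by (simp_all add: side_pt_def turn_def eval_nat_numeral)

lemma side_pt_end: "side_pt s i s = side_pt s (Suc i) 0"
proof -
  have "side_pt s i s = (turn s ^^ i) (side_pt s 0 s)" by (simp add: side_pt_add)
  also have "\<dots> = (turn s ^^ i) (side_pt s 1 0)" by (simp add: side_pt_eqs)
  finally show ?thesis by (simp add: side_pt_add)
qed

lemma side_pt_Suc3: "side_pt s (Suc (i + 3)) t = side_pt s i t"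
  using side_pt_plus4(1)[of s i t] by (simp add: eval_nat_numeral)

lemma side_pt_corner: "side_pt s (i + 3) s = side_pt s i 0"
  using side_pt_end[of s "i + 3"] by (simp only: side_pt_Suc3)

lemma dist_side_pt_add: "dist (side_pt s (k + i) t) (side_pt s (k + j) t') = dist (side_pt s i t) (side_pt s j t')"
  using plane_isometry_funpow[OF plane_isometry_turn[of s], of k]
  by (simp add: side_pt_add[symmetric] plane_isometry_def)

lemma dist_side_pt: "dist (side_pt s i t) (side_pt s i t') = \<bar>t - t'\<bar>"
  using dist_side_pt_add[of s i 0 t 0 t'] by (simp add: side_pt_eqs dist_plane)

lemma dist_side_pt_Suc:
  "dist (side_pt s i t) (side_pt s (Suc i) t') = sqrt ((s - t)\<^sup>2 + t'\<^sup>2)"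
  using dist_side_pt_add[of s i 0 t "Suc 0" t'] by (simp add: side_pt_eqs dist_plane power2_commute)

lemma dist_side_pt_opposite: "s \<le> dist (side_pt s i t) (side_pt s (i + 2) t')"
  using dist_side_pt_add[of s i 0 t "2" t'] by (simp add: side_pt_eqs dist_plane real_le_rsqrt)

lemma side_pt_affine:
  "side_pt s i ((1 - l) * t + l * t') = (1 - l) *\<^sub>R side_pt s i t + l *\<^sub>R side_pt s i t'"
proof (induction i)
  case 0 then show ?case by (simp add: side_pt_def pt_eq_iff)
next
  case (Suc i)
  have "side_pt s (Suc i) x = turn s (side_pt s i x)" for x by (simp add: side_pt_def)
  moreover have "turn s ((1 - l) *\<^sub>R z + l *\<^sub>R w) = (1 - l) *\<^sub>R turn s z + l *\<^sub>R turn s w" for z w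
    by (simp add: turn_def pt_eq_iff algebra_simps)
  ultimately show ?case by (simp only: Suc)
qed

lemma side_pt_between:
  assumes "convex Q" "side_pt s i t \<in> Q" "side_pt s i t' \<in> Q" "t \<le> x" "x \<le> t'"
  shows "side_pt s i x \<in> Q"
proof (cases "t = t'")
  case True then show ?thesis using assms by (metis antisym)
next
  case False
  define l where "l = (x - t) / (t' - t)"
  have l: "0 \<le> l" "l \<le> 1" using assms False by (auto simp: l_def field_simps)
  have "l * (t' - t) = x - t" using False by (simp add: l_def)
  then have "x = (1 - l) * t + l * t'" by (simp add: algebra_simps)
  then show ?thesis using convexD_alt[OF assms(1-3) l] by (metis side_pt_affine)
qed

lemma continuous_side_pt: "continuous_on A (side_pt s i)"
  unfolding continuous_on_iff dist_side_pt by (metis dist_real_def)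

lemma frontier_axis_square:
  assumes "0 < s"
  shows "frontier (axis_square s) = {side_pt s i t | i t. 0 \<le> t \<and> t \<le> s}"
proof
  have *: "frontier (axis_square s) = {z. z \<in> axis_square s \<and> (z$1 = 0 \<or> z$1 = s \<or> z$2 = 0 \<or> z$2 = s)}"
    by (auto simp: axis_square_def frontier_cbox mem_box_cart forall_2)
  show "frontier (axis_square s) \<subseteq> {side_pt s i t | i t. 0 \<le> t \<and> t \<le> s}"
  proof
    fix z assume "z \<in> frontier (axis_square s)"
    then have z: "0 \<le> z$1" "z$1 \<le> s" "0 \<le> z$2" "z$2 \<le> s" and d: "z$1 = 0 \<or> z$1 = s \<or> z$2 = 0 \<or> z$2 = s"
      unfolding * by (auto simp: axis_square_def mem_box_cart forall_2)
    from d consider "z = side_pt s 3 (s - z$2)" | "z = side_pt s 1 (z$2)" | "z = side_pt s 0 (z$1)" | "z = side_pt s 2 (s - z$1)"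
      by (auto simp: side_pt_eqs pt_eq_iff)
    then show "z \<in> {side_pt s i t | i t. 0 \<le> t \<and> t \<le> s}" by cases (use z in force)+
  qed
  show "{side_pt s i t | i t. 0 \<le> t \<and> t \<le> s} \<subseteq> frontier (axis_square s)"
  proof clarify
    fix i t assume t: "0 \<le> t" "t \<le> s"
    have "pt t 0 \<in> frontier (axis_square s)"
      unfolding * using t assms by (auto simp: axis_square_def mem_box_cart forall_2)
    then have "(turn s ^^ i) (pt t 0) \<in> (turn s ^^ i) ` frontier (axis_square s)" by blast
    also have "\<dots> = frontier (axis_square s)"
      by (simp add: frontier_isometry[OF plane_isometry_funpow[OF plane_isometry_turn], symmetric] turn_pow_axis_square)
    finally show "side_pt s i t \<in> frontier (axis_square s)" by (simp add: side_pt_def)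
  qed
qed

definition meets_side :: "real \<Rightarrow> (real^2) set \<Rightarrow> nat \<Rightarrow> bool" where
  "meets_side s Q i \<longleftrightarrow> (\<exists>t. 0 \<le> t \<and> t \<le> s \<and> side_pt s i t \<in> Q)"

lemma meets_side_plus4 [simp]: "meets_side s Q (i + 4) = meets_side s Q i"
  by (simp add: meets_side_def)

lemma meets_side_opposite:
  assumes "sqrt 2 < s" "is_square 1 Q" "meets_side s Q i" shows "\<not> meets_side s Q (i + 2)"
proof
  assume "meets_side s Q (i + 2)"
  then obtain t t' where "side_pt s i t \<in> Q" "side_pt s (i + 2) t' \<in> Q"
    using assms(3) unfolding meets_side_def by blast
  then show False
    using unit_square_diameter[OF assms(2)] dist_side_pt_opposite[of s i t t'] assms(1) by force
qed

text \<open>The two points and the common corner of the sides form a right triangle whose hypotenuse lies in the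
unit square, so both legs are at most \<open>sqrt 2\<close>.\<close>

lemma adjacent_reach:
  assumes "is_square 1 Q" "side_pt s i t \<in> Q" "side_pt s (Suc i) t' \<in> Q"
  shows "s - t \<le> sqrt 2" "t' \<le> sqrt 2"
proof -
  have "sqrt ((s - t)\<^sup>2 + t'\<^sup>2) \<le> sqrt 2"
    using unit_square_diameter[OF assms] by (simp add: dist_side_pt_Suc)
  then have "(s - t)\<^sup>2 + t'\<^sup>2 \<le> 2" by simp
  moreover have "0 \<le> (s - t)\<^sup>2" "0 \<le> t'\<^sup>2" by auto
  ultimately have "(s - t)\<^sup>2 \<le> 2" "t'\<^sup>2 \<le> 2" by linarith+
  then show "s - t \<le> sqrt 2" "t' \<le> sqrt 2" by (auto intro: real_le_rsqrt)
qed

lemma corner_reach_at: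
  assumes Q: "is_square 1 Q" and uv: "0 \<le> r" "0 \<le> q"
    and mem: "side_pt s i 0 \<in> Q" "side_pt s i q \<in> Q" "side_pt s (i + 3) (s - r) \<in> Q"
  shows "(r, q) \<in> corner_reach"
proof -
  \<comment> \<open>after \<open>3 * i\<close> further quarter turns, corner \<open>i\<close> has made \<open>4 * i\<close> of them and is at the origin\<close>
  let ?h = "turn s ^^ (3 * i)"
  have h: "?h (side_pt s (i + j) t) = side_pt s j t" for j t
    using side_pt_period[of s i j t] by (simp add: side_pt_add)
  have "is_square 1 (?h ` Q)"
    using is_square_isometry[OF plane_isometry_funpow[OF plane_isometry_turn] Q] .
  moreover have "pt 0 0 \<in> ?h ` Q" "pt q 0 \<in> ?h ` Q" "pt 0 r \<in> ?h ` Q"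
    using imageI[OF mem(1), of ?h] imageI[OF mem(2), of ?h] imageI[OF mem(3), of ?h]
      h[of 0 0] h[of 0 q] h[of 3 "s - r"] by (simp_all add: side_pt_eqs)
  ultimately show ?thesis using unit_square_corner_reach uv corner_reach_swap by blast
qed

text \<open>The extreme reaches are attained because a square meets a side in a compact set.\<close>

lemma corner_reaches:
  assumes s: "0 \<le> s" and Q: "is_square 1 Q" and mem: "side_pt s i 0 \<in> Q"
  obtains r q where "(r, q) \<in> corner_reach" "r \<le> s" "q \<le> s"
    "side_pt s i q \<in> Q" "side_pt s (i + 3) (s - r) \<in> Q"
    "\<And>t. 0 \<le> t \<Longrightarrow> t \<le> s \<Longrightarrow> side_pt s i t \<in> Q \<Longrightarrow> t \<le> q"
    "\<And>t. 0 \<le> t \<Longrightarrow> t \<le> s \<Longrightarrow> side_pt s (i + 3) t \<in> Q \<Longrightarrow> s - t \<le> r"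
proof -
  have comp: "compact ({0..s} \<inter> side_pt s j -` Q)" for j
  proof -
    have "closed ({0..s} \<inter> side_pt s j -` Q)"
      by (rule continuous_closed_preimage[OF continuous_side_pt closed_atLeastAtMost unit_square_closed[OF Q]])
    then show ?thesis by (simp add: compact_eq_bounded_closed bounded_Int)
  qed
  have mem': "side_pt s (i + 3) s \<in> Q"
    using mem by (simp only: side_pt_corner)
  obtain q where q: "q \<in> {0..s} \<inter> side_pt s i -` Q" "\<forall>t\<in>{0..s} \<inter> side_pt s i -` Q. t \<le> q"
    using compact_attains_sup[OF comp[of i]] s mem by force
  obtain r where r: "r \<in> {0..s} \<inter> side_pt s (i + 3) -` Q" "\<forall>t\<in>{0..s} \<inter> side_pt s (i + 3) -` Q. r \<le> t"
    using compact_attains_inf[OF comp[of "i + 3"]] s mem' by force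
  have "(s - r, q) \<in> corner_reach"
    by (rule corner_reach_at[OF Q _ _ mem]) (use q r in auto)
  then show ?thesis by (rule that) (use q r in auto)
qed

section \<open>Coverings as four corner reaches plus spare segments\<close>

text \<open>At corner \<open>i\<close>, \<open>r i\<close> is the reach backwards along side \<open>i + 3\<close> and \<open>q i\<close> the reach forwards along side \<open>i\<close>; \<open>k i\<close>
is the number of spare squares on side \<open>i\<close>, each good for a segment of length \<open>sqrt 2\<close>. The condition
\<open>r 4 = r 0\<close> closes the cycle of the four sides.\<close>

definition reach_scheme :: "nat \<Rightarrow> real \<Rightarrow> bool" where
  "reach_scheme n s \<longleftrightarrow> (\<exists>(r :: nat \<Rightarrow> real) (q :: nat \<Rightarrow> real) (k :: nat \<Rightarrow> nat). r 4 = r 0 \<and>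
     (\<forall>i<4. (r i, q i) \<in> corner_reach \<and> s \<le> q i + k i * sqrt 2 + r (Suc i)) \<and>
     (4::nat) + sum k {..<4} \<le> n)"

text \<open>Each \<open>T j\<close> lies in an interval of length \<open>L\<close>, and Lebesgue measure is subadditive.\<close>

lemma interval_cover_length:
  fixes T :: "'i \<Rightarrow> real set" and s A B L :: real
  assumes "finite E" "0 \<le> s" "0 \<le> A" "0 \<le> B" "0 \<le> L"
    and cov: "{0..s} \<subseteq> {0..A} \<union> {s - B..s} \<union> (\<Union>j\<in>E. T j)"
    and diam: "\<And>j t t'. j \<in> E \<Longrightarrow> t \<in> T j \<Longrightarrow> t' \<in> T j \<Longrightarrow> \<bar>t - t'\<bar> \<le> L"
  shows "s \<le> A + B + card E * L"
proof -
  have "\<exists>x. T j \<subseteq> {x..x + L}" if j: "j \<in> E" for j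
  proof (cases "T j = {}")
    case False
    have bd: "t \<le> t' + L" if "t \<in> T j" "t' \<in> T j" for t t'
      using diam[OF j that] by linarith
    obtain t0 where t0: "t0 \<in> T j" using False by blast
    have "bdd_below (T j)" using bd[OF t0] by (intro bdd_belowI[of _ "t0 - L"]) (simp add: diff_le_eq)
    moreover have "t - L \<le> Inf (T j)" if "t \<in> T j" for t
      using bd[OF that] False by (intro cInf_greatest) (auto simp: diff_le_eq)
    ultimately have "T j \<subseteq> {Inf (T j)..Inf (T j) + L}"
      by (auto intro: cInf_lower simp: diff_le_eq)
    then show ?thesis by blast
  qed auto
  then obtain x where x: "\<And>j. j \<in> E \<Longrightarrow> T j \<subseteq> {x j..x j + L}" by metis
  let ?U = "\<Union>j\<in>E. {x j..x j + L}"
  have fm: "{a..b} \<in> fmeasurable lborel" for a b :: real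
    by (rule fmeasurableI) (auto simp: emeasure_lborel_Icc_eq)
  have "{0..s} \<subseteq> ({0..A} \<union> {s - B..s}) \<union> ?U" using cov x by blast
  then have "measure lborel {0..s} \<le> measure lborel (({0..A} \<union> {s - B..s}) \<union> ?U)"
    by (intro measure_mono_fmeasurable) (auto intro!: fmeasurable.Un fmeasurable.finite_UN assms(1) fm)
  also have "\<dots> \<le> measure lborel ({0..A} \<union> {s - B..s}) + measure lborel ?U"
    by (intro measure_Un_le) (auto simp: assms(1))
  also have "measure lborel ({0..A} \<union> {s - B..s}) \<le> measure lborel {0..A} + measure lborel {s - B..s}"
    by (intro measure_Un_le) auto
  also have "measure lborel ?U \<le> (\<Sum>j\<in>E. measure lborel {x j..x j + L})"
    by (intro measure_UNION_le assms) auto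
  finally show ?thesis using assms by (simp add: algebra_simps)
qed

locale boundary_covering =
  fixes s :: real and n :: nat and F :: "nat \<Rightarrow> (real^2) set"
  assumes long: "sqrt 2 < s"
    and unit: "unit_square_family n F"
    and covering: "covers n F (frontier (axis_square s))"
begin

lemma s_pos: "0 < s"
  using long real_sqrt_gt_zero[of 2] by linarith

lemma unitD: "j < n \<Longrightarrow> is_square 1 (F j)"
  using unit by (simp add: unit_square_family_def)

lemma covered:
  assumes "0 \<le> t" "t \<le> s" obtains j where "j < n" "side_pt s i t \<in> F j"
  using covering assms unfolding covers_def frontier_axis_square[OF s_pos] by fast

definition at_corner :: "nat \<Rightarrow> nat set" where
  "at_corner i = {j. j < n \<and> meets_side s (F j) i \<and> meets_side s (F j) (i + 3)}"

text \<open>A unit square that touches the boundary meets one side or two consecutive ones, and it is attributed to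
the last of these. Thus every square is counted once, and the squares at corner \<open>i\<close> are all
attributed to side \<open>i\<close>.\<close>

definition owned :: "nat \<Rightarrow> nat set" where
  "owned i = {j. j < n \<and> meets_side s (F j) i \<and> \<not> meets_side s (F j) (Suc i)}"

lemma at_corner_plus4: "at_corner (i + 4) = at_corner i"
  using meets_side_plus4[of s _ "i + 3"] by (simp add: at_corner_def add.commute add.left_commute)

lemma at_corner_owned: "at_corner i \<subseteq> owned i"
proof
  fix j assume "j \<in> at_corner i"
  then have j: "j < n" "meets_side s (F j) i" "meets_side s (F j) (i + 3)" by (auto simp: at_corner_def)
  have "\<not> meets_side s (F j) (i + 3 + 2)" by (rule meets_side_opposite[OF long unitD[OF j(1)] j(3)])
  moreover have "i + 3 + 2 = Suc i + 4" by simp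
  then have "meets_side s (F j) (i + 3 + 2) \<longleftrightarrow> meets_side s (F j) (Suc i)"
    by (rule ssubst) (rule meets_side_plus4)
  ultimately have "\<not> meets_side s (F j) (Suc i)" by blast
  then show "j \<in> owned i" using j by (simp add: owned_def)
qed

lemma at_corner_Suc_iff:
  "j \<in> at_corner (Suc i) \<longleftrightarrow> j < n \<and> meets_side s (F j) i \<and> meets_side s (F j) (Suc i)"
  using meets_side_plus4[of s "F j" i] by (auto simp: at_corner_def add.commute)

lemma finite_owned: "finite (owned i)" "finite (at_corner i)"
  by (auto simp: owned_def at_corner_def)

lemma contains_corner:
  obtains j where "j < n" "side_pt s i 0 \<in> F j" "j \<in> at_corner i"
proof -
  obtain j where j: "j < n" "side_pt s i 0 \<in> F j"
    using covered[of 0 i] less_imp_le[OF s_pos] by blast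
  have "side_pt s (i + 3) s = side_pt s i 0" by (rule side_pt_corner)
  then have "j \<in> at_corner i" using j s_pos unfolding at_corner_def meets_side_def
    by (auto intro: exI[of _ 0] exI[of _ s])
  then show ?thesis using j that by blast
qed

lemma card_at_corner_pos: "1 \<le> card (at_corner i)"
proof -
  have "at_corner i \<noteq> {}" using contains_corner[of i] by blast
  then show ?thesis using finite_owned(2)[of i] by (simp add: Suc_le_eq card_gt_0_iff)
qed

lemma sum_owned: "(\<Sum>i<4. card (owned i)) \<le> n"
proof -
  have "owned i \<inter> owned i' = {}" if i: "i < i'" "i' < 4" for i i'
  proof -
    consider "i' = Suc i" | "i' = i + 2" | "i' = i + 3" using i by linarith
    then show ?thesis
    proof cases
      case 1 then show ?thesis by (auto simp: owned_def)
    next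
      case 2 then show ?thesis using meets_side_opposite[OF long unitD] by (auto simp: owned_def)
    next
      case 3 then show ?thesis using meets_side_plus4[of s _ i] by (auto simp: owned_def add.commute)
    qed
  qed
  then have "owned i \<inter> owned i' = {}" if "i \<noteq> i'" "i < 4" "i' < 4" for i i'
    using that by (metis inf_commute linorder_neqE_nat)
  then have "(\<Sum>i<4. card (owned i)) = card (\<Union>i<4. owned i)"
    by (subst card_UN_disjoint) (auto simp: finite_owned)
  also have "\<dots> \<le> card {..<n}" by (intro card_mono) (auto simp: owned_def)
  finally show ?thesis by simp
qed

text \<open>The reaches \<open>r\<close> and \<open>q\<close> may stand for the squares at corner \<open>i\<close> if all but one of these are traded for spare
segments on side \<open>i\<close>; this is the summand with the cardinality.\<close>

definition bounds_corner :: "nat \<Rightarrow> real \<Rightarrow> real \<Rightarrow> bool" where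
  "bounds_corner i r q \<longleftrightarrow> (r, q) \<in> corner_reach \<and> (\<forall>j\<in>at_corner i. \<forall>t. 0 \<le> t \<and> t \<le> s \<longrightarrow>
     (side_pt s i t \<in> F j \<longrightarrow> t \<le> q + (real (card (at_corner i)) - 1) * sqrt 2) \<and>
     (side_pt s (i + 3) t \<in> F j \<longrightarrow> s - t \<le> r))"

lemma bounds_corner_plus4: "bounds_corner (i + 4) = bounds_corner i"
proof -
  have "side_pt s (i + 4 + 3) t = side_pt s (i + 3) t" for t
    using side_pt_plus4(1)[of s "i + 3" t] by (simp add: add.commute add.left_commute)
  then show ?thesis by (simp add: fun_eq_iff bounds_corner_def at_corner_plus4)
qed

text \<open>A single square at the corner has its own extreme reaches. Several squares all stay within \<open>sqrt 2\<close> of the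
corner, so the pair \<open>(sqrt 2, 0)\<close> and one spare segment already dominate them.\<close>

lemma bounds_corner_exists: "\<exists>r q. bounds_corner i r q"
proof -
  obtain j where j: "j < n" "side_pt s i 0 \<in> F j" "j \<in> at_corner i" by (rule contains_corner)
  show ?thesis
  proof (cases "card (at_corner i) = 1")
    case True
    then have C: "at_corner i = {j}" using j(3) by (metis card_1_singletonE singletonD)
    obtain r q where "(r, q) \<in> corner_reach"
      "\<And>t. 0 \<le> t \<Longrightarrow> t \<le> s \<Longrightarrow> side_pt s i t \<in> F j \<Longrightarrow> t \<le> q"
      "\<And>t. 0 \<le> t \<Longrightarrow> t \<le> s \<Longrightarrow> side_pt s (i + 3) t \<in> F j \<Longrightarrow> s - t \<le> r"
      using corner_reaches[OF less_imp_le[OF s_pos] unitD[OF j(1)] j(2)] by metis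
    then show ?thesis unfolding bounds_corner_def C by auto
  next
    case False
    then have two: "2 \<le> card (at_corner i)" using card_at_corner_pos[of i] by linarith
    have per: "side_pt s (Suc (i + 3)) t = side_pt s i t" for t
      by (rule side_pt_Suc3)
    have "t \<le> sqrt 2" if j: "j \<in> at_corner i" and t: "side_pt s i t \<in> F j" for j t
    proof -
      obtain t' where "side_pt s (i + 3) t' \<in> F j" "j < n" using j by (auto simp: at_corner_def meets_side_def)
      then show ?thesis using adjacent_reach(2)[OF unitD] t per by metis
    qed
    moreover have "sqrt 2 \<le> 0 + (real (card (at_corner i)) - 1) * sqrt 2"
      using two by simp
    moreover have "s - t \<le> sqrt 2" if j: "j \<in> at_corner i" and t: "side_pt s (i + 3) t \<in> F j" for j t
    proof -
      obtain t' where "side_pt s i t' \<in> F j" "j < n" using j by (auto simp: at_corner_def meets_side_def)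
      then show ?thesis using adjacent_reach(1)[OF unitD] t per by metis
    qed
    moreover have "(sqrt 2, 0) \<in> corner_reach" by (simp add: corner_reach_def)
    ultimately have "bounds_corner i (sqrt 2) 0" unfolding bounds_corner_def by (meson order_trans)
    then show ?thesis by blast
  qed
qed

text \<open>Side \<open>i\<close> is covered by the squares attributed to it and by those at corner \<open>i + 1\<close>. Choosing the bounds by
\<open>SOME\<close> makes them periodic in \<open>i\<close>, because the property that they are chosen for is.\<close>

theorem reach_scheme_exists: "reach_scheme n s"
proof -
  define rq where "rq i = (SOME x. bounds_corner i (fst x) (snd x))" for i
  define r q where "r i = fst (rq i)" and "q i = snd (rq i)" for i
  have rq: "bounds_corner i (r i) (q i)" for i
    unfolding r_def q_def rq_def by (rule someI_ex) (use bounds_corner_exists[of i] in auto)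
  define k where "k i = card (owned i) - 1" for i
  have card_le: "card (at_corner i) \<le> card (owned i)" for i
    by (rule card_mono[OF finite_owned(1) at_corner_owned])
  have "r (0 + 4) = r 0" unfolding r_def rq_def bounds_corner_plus4 by simp
  then have "r 4 = r 0" by simp
  moreover have "(r i, q i) \<in> corner_reach" for i using rq[of i] by (simp add: bounds_corner_def)
  moreover have "s \<le> q i + k i * sqrt 2 + r (Suc i)" for i
  proof -
    define A where "A = q i + (real (card (at_corner i)) - 1) * sqrt 2"
    define E where "E = owned i - at_corner i"
    define T where "T j = {t. 0 \<le> t \<and> t \<le> s \<and> side_pt s i t \<in> F j}" for j
    have nonneg: "0 \<le> q i" "0 \<le> r (Suc i)"
      using corner_reach_nonneg rq[of i] rq[of "Suc i"] unfolding bounds_corner_def by blast+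
    have cE: "real (card E) = real (card (owned i)) - real (card (at_corner i))"
      unfolding E_def using at_corner_owned[of i] finite_owned[of i] card_le[of i]
      by (simp add: card_Diff_subset of_nat_diff)
    have "s \<le> A + r (Suc i) + card E * sqrt 2"
    proof (rule interval_cover_length)
      show "finite E" by (simp add: E_def finite_owned)
      show "0 \<le> s" using s_pos by simp
      show "0 \<le> A" using nonneg card_at_corner_pos[of i] by (simp add: A_def)
      show "0 \<le> r (Suc i)" by (rule nonneg)
      show "(0 :: real) \<le> sqrt 2" by simp
      show "\<bar>t - t'\<bar> \<le> sqrt 2" if "j \<in> E" "t \<in> T j" "t' \<in> T j" for j t t'
      proof -
        have "j < n" "side_pt s i t \<in> F j" "side_pt s i t' \<in> F j"
          using that by (auto simp: E_def owned_def T_def)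
        then show ?thesis using unit_square_diameter[OF unitD] by (simp add: dist_side_pt[symmetric, of t t' s i])
      qed
      show "{0..s} \<subseteq> {0..A} \<union> {s - r (Suc i)..s} \<union> (\<Union>j\<in>E. T j)"
      proof
        fix t assume "t \<in> {0..s}"
        then have t: "0 \<le> t" "t \<le> s" by auto
        obtain j where j: "j < n" "side_pt s i t \<in> F j" using covered[OF t] by blast
        have M: "meets_side s (F j) i" using t j(2) by (auto simp: meets_side_def)
        consider "j \<in> at_corner (Suc i)" | "j \<in> at_corner i" | "j \<in> E"
          using at_corner_Suc_iff[of j i] M j(1) by (auto simp: E_def owned_def)
        then show "t \<in> {0..A} \<union> {s - r (Suc i)..s} \<union> (\<Union>j\<in>E. T j)"
        proof cases
          case 1
          have "side_pt s (Suc i + 3) t \<in> F j" using j(2) side_pt_plus4(1)[of s i t] by (simp add: eval_nat_numeral)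
          then have "s - t \<le> r (Suc i)" using rq[of "Suc i"] 1 t unfolding bounds_corner_def by blast
          then show ?thesis using t by simp
        next
          case 2
          then have "t \<le> A" using rq[of i] j t unfolding bounds_corner_def A_def by blast
          then show ?thesis using t by simp
        next
          case 3 then show ?thesis using j t by (auto simp: T_def)
        qed
      qed
    qed
    moreover have "real (card (owned i)) = real (k i) + 1"
      using card_le[of i] card_at_corner_pos[of i] by (simp add: k_def of_nat_diff)
    ultimately show ?thesis unfolding A_def cE by (simp add: algebra_simps)
  qed
  moreover have "4 + (\<Sum>i<4. k i) \<le> n"
  proof -
    have "card (owned i) = 1 + k i" for i
      using card_le[of i] card_at_corner_pos[of i] by (simp add: k_def)
    then have "(\<Sum>i<4. card (owned i)) = 4 + (\<Sum>i<4. k i)" by (simp add: sum_Suc)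
    then show ?thesis using sum_owned by simp
  qed
  ultimately show ?thesis
    unfolding reach_scheme_def by - (rule exI[of _ r], rule exI[of _ q], rule exI[of _ k], simp)
qed

end

subsection \<open>From a scheme to a covering\<close>

definition coverable :: "nat \<Rightarrow> (real^2) set \<Rightarrow> bool" where
  "coverable n X \<longleftrightarrow> (\<exists>F. unit_square_family n F \<and> covers n F X)"

lemma coverable_subset: "coverable n X \<Longrightarrow> Y \<subseteq> X \<Longrightarrow> coverable n Y"
  unfolding coverable_def covers_def by blast

lemma coverable_one: "is_square 1 Q \<Longrightarrow> X \<subseteq> Q \<Longrightarrow> coverable 1 X"
  unfolding coverable_def covers_def unit_square_family_def by (intro exI[of _ "\<lambda>_. Q"]) auto

lemma coverable_empty: "coverable 0 {}"
  by (auto simp: coverable_def covers_def unit_square_family_def)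

lemma coverable_Un:
  assumes "coverable m X" "coverable n Y" shows "coverable (m + n) (X \<union> Y)"
proof -
  obtain F G where F: "unit_square_family m F" "covers m F X" and G: "unit_square_family n G" "covers n G Y"
    using assms unfolding coverable_def by blast
  define H where "H i = (if i < m then F i else G (i - m))" for i
  have "unit_square_family (m + n) H"
    using F G by (auto simp: unit_square_family_def H_def)
  moreover have "(\<Union>i<m. F i) \<subseteq> (\<Union>i<m + n. H i)" by (force simp: H_def)
  moreover have "(\<Union>i<n. G i) \<subseteq> (\<Union>i<m + n. H i)"
  proof clarify
    fix x i assume "i < n" "x \<in> G i"
    then have "m + i < m + n" "x \<in> H (m + i)" by (auto simp: H_def)
    then show "x \<in> (\<Union>i<m + n. H i)" by blast
  qed
  ultimately have "unit_square_family (m + n) H" "covers (m + n) H (X \<union> Y)"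
    using F(2) G(2) unfolding covers_def by (simp_all add: Un_least order_trans)
  then show ?thesis unfolding coverable_def by blast
qed

lemma coverable_more: assumes "coverable m X" "m \<le> n" shows "coverable n X"
proof -
  have Q: "is_square 1 (frame_square 1 0 0 0)" by (rule frame_square_unit) simp
  have "coverable k {}" for k
  proof (induction k)
    case (Suc k) then show ?case using coverable_Un[OF Suc coverable_one[OF Q, of "{}"]] by simp
  qed (rule coverable_empty)
  then have "coverable (m + (n - m)) (X \<union> {})" by (intro coverable_Un assms)
  then show ?thesis using assms(2) by simp
qed

lemma coverable_UN:
  fixes m :: nat and k :: "nat \<Rightarrow> nat"
  assumes "\<And>i. i < m \<Longrightarrow> coverable (k i) (X i)"
  shows "coverable (\<Sum>i<m. k i) (\<Union>i<m. X i)"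
  using assms
proof (induction m)
  case 0 then show ?case by (simp add: coverable_empty)
next
  case (Suc m)
  then have "coverable ((\<Sum>i<m. k i) + k m) ((\<Union>i<m. X i) \<union> X m)" by (intro coverable_Un) auto
  then show ?case by (simp add: lessThan_Suc Un_commute add.commute)
qed

lemma unit_square_at_side:
  assumes "(r, q) \<in> corner_reach"
  obtains Q where "is_square 1 Q" "side_pt s i 0 \<in> Q" "side_pt s i q \<in> Q" "side_pt s (i + 3) (s - r) \<in> Q"
proof -
  obtain Q where Q: "is_square 1 Q" "pt 0 0 \<in> Q" "pt q 0 \<in> Q" "pt 0 r \<in> Q"
    using corner_reach_attained assms corner_reach_swap by blast
  let ?g = "turn s ^^ i"
  have "is_square 1 (?g ` Q)"
    using is_square_isometry[OF plane_isometry_funpow[OF plane_isometry_turn] Q(1)] .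
  moreover have "side_pt s i 0 = ?g (pt 0 0)" "side_pt s i q = ?g (pt q 0)"
    "side_pt s (i + 3) (s - r) = ?g (pt 0 r)"
    using side_pt_add[of i s 3 "s - r"] by (simp_all add: side_pt_def[of s i] side_pt_eqs)
  ultimately show ?thesis using that[of "?g ` Q"] Q by simp
qed

lemma coverable_segment: "coverable 1 {side_pt s i t | t. x \<le> t \<and> t \<le> x + sqrt 2}"
proof -
  have "(sqrt 2, 0) \<in> corner_reach" by (simp add: corner_reach_def)
  then obtain Q where Q: "is_square 1 Q" "pt 0 0 \<in> Q" "pt (sqrt 2) 0 \<in> Q"
    using corner_reach_attained by blast
  let ?g = "(turn s ^^ i) \<circ> (\<lambda>z. z + pt x 0)"
  have "plane_isometry (\<lambda>z. z + pt x 0)" by (simp add: plane_isometry_def)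
  then have g: "plane_isometry ?g" by (intro plane_isometry_comp plane_isometry_funpow plane_isometry_turn)
  have P: "is_square 1 (?g ` Q)" by (rule is_square_isometry[OF g Q(1)])
  have "pt 0 0 + pt x 0 = pt x 0" "pt (sqrt 2) 0 + pt x 0 = pt (x + sqrt 2) 0" by (simp_all add: pt_eq_iff)
  then have ends: "side_pt s i x = ?g (pt 0 0)" "side_pt s i (x + sqrt 2) = ?g (pt (sqrt 2) 0)"
    by (simp_all add: side_pt_def)
  have "side_pt s i x \<in> ?g ` Q" "side_pt s i (x + sqrt 2) \<in> ?g ` Q" unfolding ends using Q by blast+
  then have "{side_pt s i t | t. x \<le> t \<and> t \<le> x + sqrt 2} \<subseteq> ?g ` Q"
    using side_pt_between[OF unit_square_convex[OF P]] by blast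
  then show ?thesis by (rule coverable_one[OF P])
qed

text \<open>Squares with consecutive segments of the side as diagonals.\<close>

lemma coverable_segments: "coverable k {side_pt s i t | t. x \<le> t \<and> t < x + k * sqrt 2}"
proof -
  let ?X = "\<lambda>l::nat. {side_pt s i t | t. x + l * sqrt 2 \<le> t \<and> t \<le> x + l * sqrt 2 + sqrt 2}"
  have "coverable (\<Sum>l<k. 1) (\<Union>l<k. ?X l)"
    by (rule coverable_UN) (rule coverable_segment)
  moreover have "{side_pt s i t | t. x \<le> t \<and> t < x + k * sqrt 2} \<subseteq> (\<Union>l<k. ?X l)"
  proof clarify
    fix t assume t: "x \<le> t" "t < x + k * sqrt 2"
    define l where "l = nat \<lfloor>(t - x) / sqrt 2\<rfloor>"
    have "0 \<le> (t - x) / sqrt 2" using t by simp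
    then have "real l \<le> (t - x) / sqrt 2" "(t - x) / sqrt 2 < real l + 1" unfolding l_def by linarith+
    then have l: "x + l * sqrt 2 \<le> t" "t < x + l * sqrt 2 + sqrt 2" by (simp_all add: field_simps)
    have "real l * sqrt 2 < real k * sqrt 2" using l t by linarith
    then have "l < k" by simp
    then show "side_pt s i t \<in> (\<Union>l<k. ?X l)" using l by force
  qed
  ultimately show ?thesis by (simp add: coverable_subset)
qed

text \<open>Place a square at every corner and fill the gap on side \<open>i\<close> from the end of the reach \<open>q i\<close> onwards.\<close>

theorem coverable_of_reach_scheme:
  assumes "reach_scheme n s" "0 < s" shows "coverable n (frontier (axis_square s))"
proof -
  obtain r q :: "nat \<Rightarrow> real" and k :: "nat \<Rightarrow> nat" where r4: "r 4 = r 0"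
    and rq: "\<And>i. i < 4 \<Longrightarrow> (r i, q i) \<in> corner_reach"
    and len: "\<And>i. i < 4 \<Longrightarrow> s \<le> q i + k i * sqrt 2 + r (Suc i)"
    and n: "(4::nat) + sum k {..<4} \<le> n"
    using assms(1) unfolding reach_scheme_def by blast
  define Y where "Y i = {side_pt s i t | t. 0 \<le> t \<and> t \<le> q i} \<union> {side_pt s (i + 3) t | t. s - r i \<le> t \<and> t \<le> s}" for i
  define Z where "Z i = {side_pt s i t | t. q i \<le> t \<and> t < q i + k i * sqrt 2}" for i
  have Y: "coverable 1 (Y i)" if i: "i < 4" for i
  proof -
    obtain Q where Q: "is_square 1 Q" "side_pt s i 0 \<in> Q" "side_pt s i (q i) \<in> Q" "side_pt s (i + 3) (s - r i) \<in> Q"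
      using unit_square_at_side[OF rq[OF i]] by blast
    have "side_pt s (i + 3) s \<in> Q"
      using Q(2) by (simp only: side_pt_corner)
    then have "Y i \<subseteq> Q" unfolding Y_def
      using side_pt_between[OF unit_square_convex[OF Q(1)]] Q by blast
    then show ?thesis by (rule coverable_one[OF Q(1)])
  qed
  have "coverable (\<Sum>i<4. 1 + k i) (\<Union>i<4. Y i \<union> Z i)"
    by (intro coverable_UN coverable_Un Y) (auto simp: Z_def intro: coverable_segments)
  moreover have "(\<Sum>i<4. 1 + k i) \<le> n" using n by (simp add: sum_Suc)
  moreover have "frontier (axis_square s) \<subseteq> (\<Union>i<4. Y i \<union> Z i)"
  proof
    fix z assume "z \<in> frontier (axis_square s)"
    then obtain i' t where t: "0 \<le> t" "t \<le> s" and z': "z = side_pt s i' t"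
      unfolding frontier_axis_square[OF assms(2)] by blast
    define i where "i = i' mod 4"
    have z: "z = side_pt s i t" by (simp add: i_def z' side_pt_mod4)
    have i: "i < 4" by (simp add: i_def)
    consider "t \<le> q i" | "q i \<le> t" "t < q i + k i * sqrt 2" | "s - r (Suc i) \<le> t"
      using len[OF i] by linarith
    then show "z \<in> (\<Union>i<4. Y i \<union> Z i)"
    proof cases
      case 1 then have "z \<in> Y i" using t z by (auto simp: Y_def)
      then show ?thesis using i by blast
    next
      case 2 then have "z \<in> Z i" using t z by (auto simp: Z_def)
      then show ?thesis using i by blast
    next
      case 3
      show ?thesis
      proof (cases "i = 3")
        case True
        then have "z \<in> Y 0" using 3 t z r4 by (auto simp: Y_def eval_nat_numeral)
        then show ?thesis by force
      next
        case False
        have "z = side_pt s (Suc i + 3) t" using z side_pt_plus4(1)[of s i t] by (simp add: eval_nat_numeral)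
        then have "z \<in> Y (Suc i)" using 3 t by (auto simp: Y_def)
        moreover have "Suc i < 4" using False i by simp
        ultimately show ?thesis by blast
      qed
    qed
  qed
  ultimately show ?thesis using coverable_more coverable_subset by blast
qed

section \<open>The maximal edge length\<close>

lemma all_less_4: "(\<forall>i<4. P i) \<longleftrightarrow> P 0 \<and> P 1 \<and> P 2 \<and> P (3::nat)"
  by (auto simp: numeral_eq_Suc less_Suc_eq)

lemma sum_less_4: "sum f {..<4::nat} = f 0 + f 1 + f 2 + (f 3 :: 'a :: comm_monoid_add)"
  by (simp add: numeral_eq_Suc lessThan_Suc add.commute add.left_commute)

lemma is_square_axis_square: "0 < s \<Longrightarrow> is_square s (axis_square s)"
proof -
  assume "0 < s"
  have "axis_square s = {0 + x *\<^sub>R pt 1 0 + y *\<^sub>R pt 0 1 | x y. 0 \<le> x \<and> x \<le> s \<and> 0 \<le> y \<and> y \<le> s}"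
  proof (intro equalityI subsetI)
    fix z assume "z \<in> axis_square s"
    then show "z \<in> {0 + x *\<^sub>R pt 1 0 + y *\<^sub>R pt 0 1 | x y. 0 \<le> x \<and> x \<le> s \<and> 0 \<le> y \<and> y \<le> s}"
      by (intro CollectI exI[of _ "z$1"] exI[of _ "z$2"])
         (auto simp: axis_square_def mem_box_cart forall_2 pt_eq_iff)
  qed (auto simp: axis_square_def mem_box_cart forall_2)
  then show ?thesis using \<open>0 < s\<close> unfolding is_square_def
    by (intro conjI exI[of _ 0] exI[of _ "pt 1 0"] exI[of _ "pt 0 1"]) (auto simp: norm_plane inner_plane)
qed

lemma boundary_covering_image:
  assumes "sqrt 2 < s" "plane_isometry g" "g ` S = axis_square s"
    "unit_square_family n F" "covers n F (frontier S)"
  shows "boundary_covering s n (\<lambda>i. g ` F i)"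
proof
  show "unit_square_family n (\<lambda>i. g ` F i)"
    using assms(2,4) is_square_isometry unfolding unit_square_family_def by blast
  have "frontier (axis_square s) = g ` frontier S" using frontier_isometry[OF assms(2)] assms(3) by metis
  then show "covers n (\<lambda>i. g ` F i) (frontier (axis_square s))"
    using assms(5) unfolding covers_def by blast
qed (rule assms)

lemma coverable_iff_reach_scheme:
  assumes "sqrt 2 < s"
  shows "(\<exists>S F. is_square s S \<and> unit_square_family n F \<and> covers n F (frontier S)) \<longleftrightarrow> reach_scheme n s"
proof
  assume "\<exists>S F. is_square s S \<and> unit_square_family n F \<and> covers n F (frontier S)"
  then obtain S F where S: "is_square s S" and F: "unit_square_family n F" "covers n F (frontier S)" by blast
  obtain g where "plane_isometry g" "g ` S = axis_square s" using is_square_axis[OF S] by blast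
  then show "reach_scheme n s"
    using boundary_covering_image[OF assms _ _ F] boundary_covering.reach_scheme_exists by blast
next
  assume r: "reach_scheme n s"
  have "0 < s" using assms sqrt2_bounds by linarith
  then show "\<exists>S F. is_square s S \<and> unit_square_family n F \<and> covers n F (frontier S)"
    using coverable_of_reach_scheme[OF r] is_square_axis_square unfolding coverable_def by blast
qed

text \<open>The edge length that is afforded by given numbers of spare segments and given corner reaches. Taking the
reaches from a product space makes continuity and compactness directly applicable.\<close>

definition scheme_length :: "nat \<times> nat \<times> nat \<times> nat \<Rightarrow>
    (real \<times> real) \<times> (real \<times> real) \<times> (real \<times> real) \<times> (real \<times> real) \<Rightarrow> real" where
  "scheme_length = (\<lambda>(k0, k1, k2, k3) x.
     min (min (snd (fst x) + k0 * sqrt 2 + fst (fst (snd x)))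
              (snd (fst (snd x)) + k1 * sqrt 2 + fst (fst (snd (snd x)))))
         (min (snd (fst (snd (snd x))) + k2 * sqrt 2 + fst (snd (snd (snd x))))
              (snd (snd (snd (snd x))) + k3 * sqrt 2 + fst (fst x))))"

abbreviation reach_configurations where
  "reach_configurations \<equiv> corner_reach \<times> corner_reach \<times> corner_reach \<times> corner_reach"

definition segment_distributions :: "nat \<Rightarrow> (nat \<times> nat \<times> nat \<times> nat) set" where
  "segment_distributions n = {(k0, k1, k2, k3). 4 + k0 + k1 + k2 + k3 \<le> n}"

lemma reach_scheme_iff:
  "reach_scheme n s \<longleftrightarrow>
     (\<exists>k\<in>segment_distributions n. \<exists>x\<in>reach_configurations. s \<le> scheme_length k x)"
proof
  assume "reach_scheme n s"
  then obtain r q :: "nat \<Rightarrow> real" and k :: "nat \<Rightarrow> nat" where r4: "r 4 = r 0"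
    and rq: "\<forall>i<4. (r i, q i) \<in> corner_reach \<and> s \<le> q i + k i * sqrt 2 + r (Suc i)"
    and n: "(4::nat) + sum k {..<4} \<le> n"
    unfolding reach_scheme_def by blast
  have "(k 0, k 1, k 2, k 3) \<in> segment_distributions n"
    using n by (simp add: segment_distributions_def sum_less_4 add.assoc)
  moreover have "((r 0, q 0), (r 1, q 1), (r 2, q 2), (r 3, q 3)) \<in> reach_configurations"
    using rq by (simp add: all_less_4)
  moreover have "s \<le> scheme_length (k 0, k 1, k 2, k 3) ((r 0, q 0), (r 1, q 1), (r 2, q 2), (r 3, q 3))"
    using rq r4 by (simp add: all_less_4 scheme_length_def numeral_2_eq_2[symmetric])
  ultimately show "\<exists>k\<in>segment_distributions n. \<exists>x\<in>reach_configurations. s \<le> scheme_length k x" by blast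
next
  assume "\<exists>k\<in>segment_distributions n. \<exists>x\<in>reach_configurations. s \<le> scheme_length k x"
  then obtain k0 k1 k2 k3 r0 q0 r1 q1 r2 q2 r3 q3 where
    k: "(k0, k1, k2, k3) \<in> segment_distributions n"
    and x: "(r0, q0) \<in> corner_reach" "(r1, q1) \<in> corner_reach" "(r2, q2) \<in> corner_reach" "(r3, q3) \<in> corner_reach"
    and s: "s \<le> scheme_length (k0, k1, k2, k3) ((r0, q0), (r1, q1), (r2, q2), (r3, q3))"
    by (auto simp: mem_Times_iff)
  define r where "r i = [r0, r1, r2, r3, r0] ! i" for i
  define q where "q i = [q0, q1, q2, q3] ! i" for i
  define k where "k i = [k0, k1, k2, k3] ! i" for i
  have "r 4 = r 0" by (simp add: r_def)
  moreover have "\<forall>i<4. (r i, q i) \<in> corner_reach \<and> s \<le> q i + k i * sqrt 2 + r (Suc i)"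
    using s x by (simp add: all_less_4 r_def q_def k_def scheme_length_def)
  moreover have "(4::nat) + sum k {..<4} \<le> n"
    using k by (simp add: segment_distributions_def sum_less_4 k_def)
  ultimately show "reach_scheme n s"
    unfolding reach_scheme_def by - (rule exI[of _ r], rule exI[of _ q], rule exI[of _ k], simp)
qed

lemma reach_scheme_maximum:
  assumes "4 \<le> n" obtains M where "reach_scheme n M" "\<And>s. reach_scheme n s \<Longrightarrow> s \<le> M"
proof -
  have comp: "compact reach_configurations" by (intro compact_Times compact_corner_reach)
  have one: "(1, 1) \<in> corner_reach" by (simp add: corner_reach_def)
  have ne: "reach_configurations \<noteq> {}" using one by blast
  have cont: "continuous_on reach_configurations (scheme_length k)" for k
    unfolding scheme_length_def by (cases k) (auto intro!: continuous_intros)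
  have "\<exists>x\<in>reach_configurations. \<forall>y\<in>reach_configurations. scheme_length k y \<le> scheme_length k x" for k
    by (rule continuous_attains_sup[OF comp ne cont])
  then obtain X where X: "\<And>k. X k \<in> reach_configurations"
    "\<And>k y. y \<in> reach_configurations \<Longrightarrow> scheme_length k y \<le> scheme_length k (X k)" by metis
  have "segment_distributions n \<subseteq> {..n} \<times> {..n} \<times> {..n} \<times> {..n}"
    by (auto simp: segment_distributions_def)
  then have fin: "finite (segment_distributions n)" by (rule finite_subset) simp
  have nek: "(0, 0, 0, 0) \<in> segment_distributions n" using assms by (simp add: segment_distributions_def)
  define M where "M = Max ((\<lambda>k. scheme_length k (X k)) ` segment_distributions n)"
  show ?thesis
  proof (rule that)
    have "M \<in> (\<lambda>k. scheme_length k (X k)) ` segment_distributions n"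
      unfolding M_def by (rule Max_in) (use fin nek in auto)
    then obtain k where "k \<in> segment_distributions n" "M = scheme_length k (X k)" by blast
    then show "reach_scheme n M"
      unfolding reach_scheme_iff by (intro bexI[of _ k] bexI[OF _ X(1)[of k]]) auto
    fix s assume "reach_scheme n s"
    then obtain k x where "k \<in> segment_distributions n" "x \<in> reach_configurations" "s \<le> scheme_length k x"
      unfolding reach_scheme_iff by blast
    moreover have "scheme_length k (X k) \<le> M" if "k \<in> segment_distributions n"
      unfolding M_def by (rule Max_ge) (use fin that in auto)
    ultimately show "s \<le> M" using X(2) by (meson order_trans)
  qed
qed

lemma reach_scheme_two: assumes "4 \<le> n" shows "reach_scheme n 2"
  unfolding reach_scheme_iff
proof (intro bexI)
  show "2 \<le> scheme_length (0, 0, 0, 0) ((1, 1), (1, 1), (1, 1), (1, 1))" by (simp add: scheme_length_def)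
  show "((1, 1), (1, 1), (1, 1), (1, 1)) \<in> reach_configurations" by (simp add: corner_reach_def)
  show "(0, 0, 0, 0) \<in> segment_distributions n" using assms by (simp add: segment_distributions_def)
qed

text \<open>Since the maximum over all schemes is attained and is at least \<open>2 > sqrt 2\<close>, coverings of smaller squares,
to which the correspondence with schemes does not apply, cannot affect it.\<close>

theorem S_bd_maximum:
  assumes "4 \<le> n" shows "reach_scheme n (S_bd n)" "reach_scheme n s \<Longrightarrow> s \<le> S_bd n"
proof -
  obtain M where M: "reach_scheme n M" "\<And>s. reach_scheme n s \<Longrightarrow> s \<le> M"
    using reach_scheme_maximum[OF assms] by blast
  have M2: "sqrt 2 < M" using M(2)[OF reach_scheme_two[OF assms]] sqrt2_bounds by linarith
  have "S_bd n = M"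
    unfolding S_bd_def
  proof (rule Greatest_equality)
    show "\<exists>S F. is_square M S \<and> unit_square_family n F \<and> covers n F (frontier S)"
      using coverable_iff_reach_scheme[OF M2] M(1) by blast
    fix y assume y: "\<exists>S F. is_square y S \<and> unit_square_family n F \<and> covers n F (frontier S)"
    show "y \<le> M"
    proof (cases "sqrt 2 < y")
      case True then show ?thesis using coverable_iff_reach_scheme y M(2) by blast
    next
      case False then show ?thesis using M2 by simp
    qed
  qed
  then show "reach_scheme n (S_bd n)" "reach_scheme n s \<Longrightarrow> s \<le> S_bd n" using M by auto
qed

lemma S_bd_ge_2: "4 \<le> n \<Longrightarrow> 2 \<le> S_bd n"
  using S_bd_maximum(2) reach_scheme_two by blast

lemma reach_scheme_insert: assumes "reach_scheme n s" shows "reach_scheme (n + 4) (s + sqrt 2)"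
proof -
  obtain r q :: "nat \<Rightarrow> real" and k :: "nat \<Rightarrow> nat" where r4: "r 4 = r 0"
    and rq: "\<forall>i<4. (r i, q i) \<in> corner_reach \<and> s \<le> q i + k i * sqrt 2 + r (Suc i)"
    and n: "(4::nat) + sum k {..<4} \<le> n"
    using assms unfolding reach_scheme_def by blast
  have "\<forall>i<4. (r i, q i) \<in> corner_reach \<and> s + sqrt 2 \<le> q i + Suc (k i) * sqrt 2 + r (Suc i)"
    using rq by (force simp: algebra_simps)
  moreover have "(4::nat) + (\<Sum>i<4. Suc (k i)) \<le> n + 4" using n by (simp add: sum_Suc)
  ultimately show ?thesis using r4
    unfolding reach_scheme_def by - (rule exI[of _ r], rule exI[of _ q], rule exI[of _ "\<lambda>i. Suc (k i)"], simp)
qed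

lemma reach_scheme_remove:
  assumes "reach_scheme (n + 4) s" "2 * sqrt 2 < s" shows "reach_scheme n (s - sqrt 2)"
proof -
  obtain r q :: "nat \<Rightarrow> real" and k :: "nat \<Rightarrow> nat" where r4: "r 4 = r 0"
    and rq: "\<And>i. i < 4 \<Longrightarrow> (r i, q i) \<in> corner_reach"
    and len: "\<And>i. i < 4 \<Longrightarrow> s \<le> q i + k i * sqrt 2 + r (Suc i)"
    and n: "(4::nat) + sum k {..<4} \<le> n + 4"
    using assms(1) unfolding reach_scheme_def by blast
  have r: "r (Suc i) \<le> sqrt 2" if "i < 4" for i
  proof (cases "i = 3")
    case True then show ?thesis using r4 corner_reach_le_sqrt2(1)[OF rq[of 0]] by (simp add: eval_nat_numeral)
  next
    case False then show ?thesis using corner_reach_le_sqrt2(1)[OF rq[of "Suc i"]] that by simp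
  qed
  \<comment> \<open>two corner reaches have total length at most \<open>2 * sqrt 2\<close>, so every side has a spare segment\<close>
  have k: "k i = Suc (k i - 1)" if "i < 4" for i
  proof -
    have "k i \<noteq> 0"
    proof
      assume "k i = 0"
      then show False using len[OF that] r[OF that] corner_reach_le_sqrt2(2)[OF rq[OF that]] assms(2) by simp
    qed
    then show ?thesis by simp
  qed
  have "s - sqrt 2 \<le> q i + real (k i - 1) * sqrt 2 + r (Suc i)" if "i < 4" for i
  proof -
    define l where "l = k i - 1"
    have "k i = Suc l" unfolding l_def by (rule k[OF that])
    then show ?thesis using len[OF that] unfolding l_def[symmetric] by (simp add: algebra_simps)
  qed
  moreover have "(4::nat) + (\<Sum>i<4. k i - 1) \<le> n"
  proof -
    have "sum k {..<4} = (\<Sum>i<4. Suc (k i - 1))" by (rule sum.cong) (use k in auto)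
    also have "\<dots> = (\<Sum>i<4. k i - 1) + 4" by (simp add: sum_Suc)
    finally show ?thesis using n by linarith
  qed
  ultimately show ?thesis using r4 rq
    unfolding reach_scheme_def by - (rule exI[of _ r], rule exI[of _ q], rule exI[of _ "\<lambda>i. k i - 1"], simp)
qed

text \<open>If \<open>S_bd (n + 4)\<close> is at most \<open>2 * sqrt 2\<close>, the upper bound is clear because \<open>2 \<le> S_bd n\<close>; otherwise one spare
segment per side can be removed.\<close>

theorem S_bd_add_4: assumes "4 \<le> n" shows "S_bd (n + 4) = S_bd n + sqrt 2"
proof (rule antisym)
  have n4: "4 \<le> n + 4" by simp
  show "S_bd n + sqrt 2 \<le> S_bd (n + 4)"
    by (rule S_bd_maximum(2)[OF n4 reach_scheme_insert[OF S_bd_maximum(1)[OF assms]]])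
  show "S_bd (n + 4) \<le> S_bd n + sqrt 2"
  proof (cases "2 * sqrt 2 < S_bd (n + 4)")
    case True
    then have "reach_scheme n (S_bd (n + 4) - sqrt 2)"
      by (rule reach_scheme_remove[OF S_bd_maximum(1)[OF n4]])
    then show ?thesis using S_bd_maximum(2)[OF assms] by fastforce
  next
    case False
    then show ?thesis using S_bd_ge_2[OF assms] sqrt2_bounds by linarith
  qed
qed

section \<open>Four unit squares\<close>

lemma reach_scheme_4: assumes "reach_scheme 4 s" shows "s \<le> 2"
proof -
  obtain r q :: "nat \<Rightarrow> real" and k :: "nat \<Rightarrow> nat" where r4: "r 4 = r 0"
    and rq: "\<forall>i<4. (r i, q i) \<in> corner_reach \<and> s \<le> q i + k i * sqrt 2 + r (Suc i)"
    and n: "(4::nat) + sum k {..<4} \<le> 4"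
    using assms unfolding reach_scheme_def by blast
  have "k 0 = 0" "k 1 = 0" "k 2 = 0" "k 3 = 0" using n by (simp_all add: sum_less_4)
  then have "s \<le> q 0 + r 1" "s \<le> q 1 + r 2" "s \<le> q 2 + r 3" "s \<le> q 3 + r 0"
    using rq r4 by (simp_all add: all_less_4 numeral_2_eq_2[symmetric])
  moreover have "r 0 + q 0 \<le> 2" "r 1 + q 1 \<le> 2" "r 2 + q 2 \<le> 2" "r 3 + q 3 \<le> 2"
    using rq corner_reach_sum(1) by (simp_all add: all_less_4)
  ultimately show ?thesis by linarith
qed

theorem S_bd_4: "S_bd 4 = 2"
  using S_bd_ge_2[of 4] reach_scheme_4 S_bd_maximum(1)[of 4] by fastforce

context boundary_covering
begin

definition corner_index :: "nat \<Rightarrow> nat" where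
  "corner_index i = (SOME j. j < n \<and> side_pt s i 0 \<in> F j)"

lemma corner_index: "corner_index i < n" "side_pt s i 0 \<in> F (corner_index i)" "corner_index i \<in> at_corner i"
proof -
  have "corner_index i < n \<and> side_pt s i 0 \<in> F (corner_index i)"
    unfolding corner_index_def by (rule someI_ex) (use contains_corner[of i] in blast)
  then show *: "corner_index i < n" "side_pt s i 0 \<in> F (corner_index i)" by auto
  have "side_pt s (i + 3) s = side_pt s i 0" by (rule side_pt_corner)
  then show "corner_index i \<in> at_corner i" using * s_pos unfolding at_corner_def meets_side_def
    by (auto intro: exI[of _ 0] exI[of _ s])
qed

lemma corner_index_mod4: "corner_index (i mod 4) = corner_index i"
  by (simp add: corner_index_def side_pt_mod4)

lemma at_corner_disjoint:
  assumes "i < i'" "i' < i + 4" shows "at_corner i \<inter> at_corner i' = {}"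
proof -
  consider "i' = Suc i" | "i' = i + 2" | "i' = i + 3" using assms by linarith
  then show ?thesis
  proof cases
    case 1
    then show ?thesis using at_corner_owned[of i] by (auto simp: at_corner_def owned_def)
  next
    case 2
    then show ?thesis using meets_side_opposite[OF long unitD, of _ i] by (auto simp: at_corner_def)
  next
    case 3
    have "i + 3 + 3 = (i + 2) + 4" by simp
    then have "meets_side s (F j) (i + 3 + 3) \<longleftrightarrow> meets_side s (F j) (i + 2)" for j
      by (rule ssubst) (rule meets_side_plus4)
    then show ?thesis using 3 meets_side_opposite[OF long unitD, of _ i] by (auto simp: at_corner_def)
  qed
qed

lemma inj_corner_index: "inj_on corner_index {..<4}"
proof -
  have "corner_index i \<noteq> corner_index i'" if "i < i'" "i' < 4" for i i'
    using that at_corner_disjoint[of i i'] corner_index(3)[of i] corner_index(3)[of i'] by auto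
  then show ?thesis by (metis inj_onI lessThan_iff linorder_neqE_nat)
qed

lemma corner_index_image: "corner_index ` {..<4} = {corner_index i, corner_index (i + 1), corner_index (i + 2), corner_index (i + 3)}"
proof
  show "corner_index ` {..<4} \<subseteq> {corner_index i, corner_index (i + 1), corner_index (i + 2), corner_index (i + 3)}"
  proof
    fix j assume "j \<in> corner_index ` {..<4}"
    then obtain l where "l < 4" and j: "j = corner_index l" by blast
    \<comment> \<open>\<open>3 * i\<close> takes the place of \<open>- i\<close> modulo four\<close>
    define e where "e = (l + 3 * i) mod 4"
    have "(i + e) mod 4 = (4 * i + l) mod 4" unfolding e_def by (simp add: mod_simps algebra_simps)
    also have "\<dots> = l" using \<open>l < 4\<close> by simp
    finally have "corner_index l = corner_index (i + e)" by (metis corner_index_mod4)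
    moreover have "e < 4" by (simp add: e_def)
    then have "e = 0 \<or> e = 1 \<or> e = 2 \<or> e = 3" by linarith
    ultimately show "j \<in> {corner_index i, corner_index (i + 1), corner_index (i + 2), corner_index (i + 3)}"
      unfolding j by auto
  qed
  have "corner_index x \<in> corner_index ` {..<4}" for x
    by (metis corner_index_mod4 imageI lessThan_iff mod_less_divisor zero_less_numeral)
  then show "{corner_index i, corner_index (i + 1), corner_index (i + 2), corner_index (i + 3)} \<subseteq> corner_index ` {..<4}"
    by auto
qed

definition exact_reach :: "nat \<Rightarrow> real \<Rightarrow> real \<Rightarrow> bool" where
  "exact_reach i r q \<longleftrightarrow> (r, q) \<in> corner_reach \<and> r \<le> s \<and> q \<le> s \<and>
     side_pt s i q \<in> F (corner_index i) \<and> side_pt s (i + 3) (s - r) \<in> F (corner_index i) \<and>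
     (\<forall>t. 0 \<le> t \<and> t \<le> s \<longrightarrow> (side_pt s i t \<in> F (corner_index i) \<longrightarrow> t \<le> q) \<and>
        (side_pt s (i + 3) t \<in> F (corner_index i) \<longrightarrow> s - t \<le> r))"

text \<open>Chosen by \<open>SOME\<close> so that it is periodic, like the property \<open>exact_reach\<close>.\<close>

definition reach_of :: "nat \<Rightarrow> real \<times> real" where
  "reach_of i = (SOME x. exact_reach i (fst x) (snd x))"

abbreviation in_reach where "in_reach i \<equiv> fst (reach_of i)"
abbreviation out_reach where "out_reach i \<equiv> snd (reach_of i)"

lemma exact_reach: "exact_reach i (in_reach i) (out_reach i)"
proof -
  obtain r q where "exact_reach i r q"
    using corner_reaches[OF less_imp_le[OF s_pos] unitD[OF corner_index(1)] corner_index(2)]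
    unfolding exact_reach_def by metis
  then have "\<exists>x. exact_reach i (fst x) (snd x)" by auto
  then show ?thesis unfolding reach_of_def by (rule someI_ex)
qed

lemma reach_of_plus4: "reach_of (i + 4) = reach_of i"
proof -
  have "corner_index (i + 4) = corner_index i" by (metis corner_index_mod4 mod_add_self2)
  moreover have "side_pt s (i + 4 + 3) t = side_pt s (i + 3) t" for t
    using side_pt_plus4(1)[of s "i + 3" t] by (simp add: add.commute add.left_commute)
  ultimately show ?thesis by (simp add: reach_of_def exact_reach_def)
qed

lemma side_cover_cases:
  assumes t: "0 \<le> t" "t \<le> s"
  obtains "t \<le> out_reach i" | "s - t \<le> in_reach (Suc i)"
  | m where "m < n" "m \<notin> corner_index ` {..<4}" "side_pt s i t \<in> F m"
proof -
  obtain j where j: "j < n" "side_pt s i t \<in> F j" using covered[OF t] by blast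
  have per: "side_pt s (Suc i + 3) t = side_pt s i t"
    using side_pt_plus4(1)[of s i t] by (simp add: eval_nat_numeral)
  have M: "meets_side s (F j) i" using j t unfolding meets_side_def by blast
  show ?thesis
  proof (cases "j \<in> corner_index ` {..<4}")
    case False then show ?thesis using j that(3) by blast
  next
    case True
    then consider "j = corner_index i" | "j = corner_index (i + 1)" | "j = corner_index (i + 2)" | "j = corner_index (i + 3)"
      unfolding corner_index_image[of i] by blast
    then show ?thesis
    proof cases
      case 1 then show ?thesis using exact_reach[of i] j t that(1) unfolding exact_reach_def by blast
    next
      case 2 then show ?thesis using exact_reach[of "Suc i"] j t that(2) per unfolding exact_reach_def by simp
    next
      case 3
      then show ?thesis using corner_index(3)[of "i + 2"] M meets_side_opposite[OF long unitD[OF j(1)] M]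
        by (simp add: at_corner_def)
    next
      case 4
      have "i + 3 + 3 = (i + 2) + 4" by simp
      then have "meets_side s (F j) (i + 3 + 3) \<longleftrightarrow> meets_side s (F j) (i + 2)"
        by (rule ssubst) (rule meets_side_plus4)
      then show ?thesis using 4 corner_index(3)[of "i + 3"] meets_side_opposite[OF long unitD[OF j(1)] M]
        by (simp add: at_corner_def)
    qed
  qed
qed

lemma reach_nonneg: "0 \<le> in_reach i" "0 \<le> out_reach i"
  using exact_reach[of i] corner_reach_nonneg unfolding exact_reach_def by blast+

lemma align:
  assumes "a + i = 4 * k + b"
  shows "(turn s ^^ a) (side_pt s (i + j) t) = side_pt s (b + j) t"
proof -
  have "a + (i + j) = 4 * k + (b + j)" using assms by simp
  then show ?thesis by (simp only: side_pt_add side_pt_period)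
qed

end

lemma homothetic_isometry:
  assumes g: "plane_isometry g" and h: "g ` Q = (\<lambda>p. c + k *\<^sub>R (p - c)) ` (g ` S)" "k \<noteq> 0"
  shows "homothetic Q S"
proof -
  obtain L where L: "orthogonal_transformation L" "g = (\<lambda>z. L z + g 0)"
    using plane_isometry_affine[OF g] by blast
  have lin: "linear L" using L(1) by (simp add: orthogonal_transformation_def)
  obtain c' where c': "c = g c'" using bij_is_surj[OF plane_isometry_bij[OF g]] by (rule surjE)
  have "c + k *\<^sub>R (g p - c) = g (c' + k *\<^sub>R (p - c'))" for p
    unfolding c' by (subst (1 2 3 4) L(2)) (simp add: linear_add[OF lin] linear_cmul[OF lin] linear_diff[OF lin])
  then have "g ` Q = g ` ((\<lambda>p. c' + k *\<^sub>R (p - c')) ` S)" by (simp add: h(1) image_image)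
  then have "Q = (\<lambda>p. c' + k *\<^sub>R (p - c')) ` S"
    by (simp only: inj_image_eq_iff[OF bij_is_inj[OF plane_isometry_bij[OF g]]])
  then show ?thesis using h(2) unfolding homothetic_def by blast
qed

text \<open>Every corner has one square of its own, and each side is covered by the two squares at its ends. Adding up the four
sides gives \<open>8\<close> as a lower bound for the sum of all reaches, and \<open>8\<close> is also the upper bound, so every pair
of reaches is \<open>(1, 1)\<close>.\<close>

theorem four_squares_homothetic:
  assumes S: "is_square 2 S" and F: "unit_square_family 4 F" "covers 4 F (frontier S)" and m: "m < 4"
  shows "homothetic (F m) S"
proof -
  obtain g where g: "plane_isometry g" "g ` S = axis_square 2" using is_square_axis[OF S] by blast
  have s2: "sqrt 2 < 2" using sqrt2_bounds by linarith
  interpret boundary_covering 2 4 "\<lambda>i. g ` F i"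
    by (rule boundary_covering_image[OF s2 g F])
  have im: "corner_index ` {..<4} = {..<4}"
    by (rule card_subset_eq) (use corner_index(1) in \<open>auto simp: card_image inj_corner_index\<close>)
  have len: "2 \<le> out_reach i + in_reach (Suc i)" for i
  proof (rule ccontr)
    assume "\<not> ?thesis"
    then have gap: "out_reach i < 2 - in_reach (Suc i)" by simp
    define t where "t = (out_reach i + (2 - in_reach (Suc i))) / 2"
    have t: "0 \<le> t" "t \<le> 2" "out_reach i < t" "in_reach (Suc i) < 2 - t"
      using gap reach_nonneg[of i] reach_nonneg[of "Suc i"] by (auto simp: t_def field_simps)
    show False
      by (rule side_cover_cases[OF t(1,2), of i]) (use t im in auto)
  qed
  have sum2: "in_reach i + out_reach i \<le> 2" for i
    using exact_reach[of i] corner_reach_sum(1) unfolding exact_reach_def by blast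
  have ones: "in_reach i = 1 \<and> out_reach i = 1" for i
  proof -
    have "reach_of (Suc (Suc (Suc (Suc i)))) = reach_of i"
      using reach_of_plus4[of i] by (simp add: eval_nat_numeral)
    then have "in_reach i + out_reach i = 2"
      using len[of i] len[of "Suc i"] len[of "Suc (Suc i)"] len[of "Suc (Suc (Suc i))"]
        sum2[of i] sum2[of "Suc i"] sum2[of "Suc (Suc i)"] sum2[of "Suc (Suc (Suc i))"] by simp
    then show ?thesis using exact_reach[of i] corner_reach_sum(2) unfolding exact_reach_def by blast
  qed
  have "m \<in> corner_index ` {..<4}" using m im by simp
  then obtain i where i: "m = corner_index i" by blast
  \<comment> \<open>these turns move corner \<open>i\<close> to the origin\<close>
  let ?h = "turn 2 ^^ (3 * i)"
  have h: "plane_isometry ?h" by (intro plane_isometry_funpow plane_isometry_turn)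
  have al: "?h (side_pt 2 (i + j) t) = side_pt 2 (0 + j) t" for j t by (rule align[of _ _ i]) simp
  have mem: "side_pt 2 i 0 \<in> g ` F m" "side_pt 2 i 1 \<in> g ` F m" "side_pt 2 (i + 3) 1 \<in> g ` F m"
    using corner_index(2)[of i] exact_reach[of i] ones[of i] i unfolding exact_reach_def by auto
  have Q: "?h ` g ` F m = axis_square 1"
  proof (rule unit_square_axis_unique)
    show "is_square 1 (?h ` g ` F m)" using is_square_isometry[OF h unitD[OF m]] .
    show "pt 0 0 \<in> ?h ` g ` F m" "pt 1 0 \<in> ?h ` g ` F m" "pt 0 1 \<in> ?h ` g ` F m"
      using imageI[OF mem(1), of ?h] imageI[OF mem(2), of ?h] imageI[OF mem(3), of ?h]
        al[of 0 0] al[of 0 1] al[of 3 1] by (simp_all add: side_pt_eqs)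
  qed
  have half: "axis_square 1 = (\<lambda>p. 0 + (1/2) *\<^sub>R (p - 0)) ` axis_square 2"
  proof
    show "axis_square 1 \<subseteq> (\<lambda>p. 0 + (1/2) *\<^sub>R (p - 0)) ` axis_square 2"
    proof
      fix z assume z: "z \<in> axis_square 1"
      have "z = 0 + (1/2) *\<^sub>R (2 *\<^sub>R z - 0)" by simp
      moreover have "2 *\<^sub>R z \<in> axis_square 2" using z by (auto simp: axis_square_def mem_box_cart forall_2)
      ultimately show "z \<in> (\<lambda>p. 0 + (1/2) *\<^sub>R (p - 0)) ` axis_square 2" by blast
    qed
  qed (auto simp: axis_square_def mem_box_cart forall_2)
  have "?h ` g ` S = axis_square 2" by (simp only: g(2) turn_pow_axis_square)
  then have "(?h \<circ> g) ` F m = (\<lambda>p. 0 + (1/2) *\<^sub>R (p - 0)) ` ((?h \<circ> g) ` S)"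
    unfolding image_comp[symmetric] Q using half by (rule ssubst)
  then show ?thesis by (rule homothetic_isometry[OF plane_isometry_comp[OF h g(1)]]) simp
qed

section \<open>The optimal scheme with one spare segment\<close>

text \<open>The equation that characterises \<open>x_bar\<close>; it says that \<open>x_bar * sqrt (x_bar\<^sup>2 - 1) = sqrt 2 - 1\<close>.\<close>

lemma x_bar_eq: "x_bar\<^sup>2 * (x_bar\<^sup>2 - 1) = (sqrt 2 - 1)\<^sup>2" and x_bar_pos: "0 < x_bar"
proof -
  define R where "R = sqrt (13 - 8 * sqrt 2)"
  have R: "0 \<le> 13 - 8 * sqrt 2" using sqrt2_bounds by linarith
  then have R2: "R\<^sup>2 = 13 - 8 * sqrt 2" and R0: "0 \<le> R" by (simp_all add: R_def)
  have x: "x_bar = sqrt 2 / 2 * sqrt (R + 1)" by (simp add: x_bar_def R_def)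
  have x2: "x_bar\<^sup>2 = (R + 1) / 2"
    unfolding x using R0 by (simp add: power_mult_distrib power_divide)
  have "x_bar\<^sup>2 * (x_bar\<^sup>2 - 1) = (R\<^sup>2 - 1) / 4"
    unfolding x2 by (simp add: power2_eq_square field_simps)
  also have "\<dots> = (sqrt 2 - 1)\<^sup>2" by (simp add: R2 power2_diff)
  finally show "x_bar\<^sup>2 * (x_bar\<^sup>2 - 1) = (sqrt 2 - 1)\<^sup>2" .
  show "0 < x_bar" unfolding x using R0 by simp
qed

lemma x_bar_bounds: "10720 / 10000 < x_bar" "x_bar < 10721 / 10000"
proof -
  \<comment> \<open>numerically, \<open>R\<close> is \<open>1.29857\<close> and \<open>x_bar\<close> is \<open>1.07205\<close>\<close>
  define R where "R = sqrt (13 - 8 * sqrt 2)"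
  have x: "x_bar = sqrt ((R + 1) / 2)"
    by (simp add: x_bar_def R_def real_sqrt_divide real_div_sqrt field_simps)
  have "129849 / 100000 < R" unfolding R_def
    by (rule real_less_rsqrt) (use sqrt2_bounds in \<open>simp add: power2_eq_square\<close>)
  then show "10720 / 10000 < x_bar" unfolding x
    by (intro real_less_rsqrt) (simp add: power2_eq_square)
  have "R < 129870 / 100000" unfolding R_def
    by (rule real_less_lsqrt) (use sqrt2_bounds in \<open>simp_all add: power2_eq_square\<close>)
  then show "x_bar < 10721 / 10000" unfolding x
    by (intro real_less_lsqrt) (simp_all add: power2_eq_square)
qed

lemma short_reach_x_bar: "short_reach x_bar = a_bar - sqrt 2"
proof -
  have "1 \<le> x_bar\<^sup>2" using x_bar_bounds by simp
  then have "(x_bar * sqrt (x_bar\<^sup>2 - 1))\<^sup>2 = (sqrt 2 - 1)\<^sup>2"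
    using x_bar_eq by (simp add: power_mult_distrib)
  moreover have "0 \<le> x_bar * sqrt (x_bar\<^sup>2 - 1)" using x_bar_pos \<open>1 \<le> x_bar\<^sup>2\<close> by simp
  ultimately have "x_bar * sqrt (x_bar\<^sup>2 - 1) = sqrt 2 - 1"
    using sqrt2_bounds by (intro power2_eq_imp_eq[of _ "sqrt 2 - 1"]) auto
  then show ?thesis by (simp add: short_reach_def a_bar_def)
qed

text \<open>The right-hand side is the tangent of \<open>short_reach\<close> at \<open>sqrt 2\<close>. After squaring, the difference of both sides
has the double root \<open>sqrt 2\<close>, and the remaining factor is nonnegative from \<open>sqrt 6 - sqrt 2 < 1.036\<close> on.\<close>

lemma short_reach_near_sqrt2:
  assumes "(1036 / 1000) \<le> u" "u \<le> sqrt 2" shows "short_reach u \<le> 2 * (sqrt 2 - u)"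
proof -
  have "3 * u - 2 * sqrt 2 \<le> u * sqrt (u\<^sup>2 - 1)"
  proof (rule power2_le_imp_le)
    have u1: "1 \<le> u\<^sup>2" using assms by simp
    have "4 \<le> u\<^sup>2 + 2 * sqrt 2 * u"
    proof -
      have "(1036 / 1000)\<^sup>2 \<le> u\<^sup>2" using assms by (intro power_mono) auto
      moreover have "(141421 / 100000) * (1036 / 1000) \<le> sqrt 2 * u" using assms sqrt2_bounds by (intro mult_mono) auto
      ultimately show ?thesis by (simp add: power2_eq_square)
    qed
    then have "0 \<le> (u - sqrt 2)\<^sup>2 * (u\<^sup>2 + 2 * sqrt 2 * u - 4)" by simp
    also have "\<dots> = u\<^sup>2 * (u\<^sup>2 - 1) - (3 * u - 2 * sqrt 2)\<^sup>2"
    proof -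
      have "(sqrt 2)\<^sup>2 = (2::real)" by simp
      moreover have "(u - t)\<^sup>2 * (u\<^sup>2 + 2 * t * u - 4) =
          u\<^sup>2 * (u\<^sup>2 - 1) - (3 * u - 2 * t)\<^sup>2 + (t\<^sup>2 - 2) * (2 * t * u - 3 * u\<^sup>2)" for t
        by (simp add: power2_eq_square algebra_simps)
      ultimately show ?thesis by simp
    qed
    finally show "(3 * u - 2 * sqrt 2)\<^sup>2 \<le> (u * sqrt (u\<^sup>2 - 1))\<^sup>2"
      using u1 by (simp add: power_mult_distrib)
    show "0 \<le> u * sqrt (u\<^sup>2 - 1)" using u1 assms by simp
  qed
  then show ?thesis by (simp add: short_reach_def)
qed

text \<open>An upper bound for the steepness of \<open>short_reach\<close> on the interval from \<open>1.036\<close>, just below \<open>a_bar / 2\<close>, to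
\<open>x_bar\<close>, by the formula for the difference quotient that is explained at \<open>short_reach_slope\<close>.\<close>

lemma short_reach_before_x_bar:
  assumes "(1036 / 1000) \<le> u" "u \<le> x_bar"
  shows "short_reach u \<le> short_reach x_bar + (33 / 10) * (x_bar - u)"
proof (cases "u = x_bar")
  case False
  define p q where "p = sqrt (u\<^sup>2 - 1)" and "q = sqrt (x_bar\<^sup>2 - 1)"
  define w where "w = p + q"
  have u2: "(1036 / 1000)\<^sup>2 \<le> u\<^sup>2" using assms by (intro power_mono) auto
  have x2: "(1072 / 1000)\<^sup>2 \<le> x_bar\<^sup>2" "x_bar\<^sup>2 \<le> (10721 / 10000)\<^sup>2" using x_bar_bounds x_bar_pos by (intro power_mono; simp)+
  have ux: "u\<^sup>2 \<le> x_bar\<^sup>2" using assms by (intro power_mono) auto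
  have p: "(27 / 100) \<le> p" unfolding p_def by (rule real_le_rsqrt) (use u2 in \<open>simp add: power2_eq_square\<close>)
  have q: "(386 / 1000) \<le> q" "q \<le> (39 / 100)"
    unfolding q_def by (rule real_le_rsqrt real_le_lsqrt; use x2 in \<open>simp add: power2_eq_square\<close>)+
  have pq: "p \<le> q" "p\<^sup>2 = u\<^sup>2 - 1" "q\<^sup>2 = x_bar\<^sup>2 - 1" using ux u2 x2 by (auto simp: p_def q_def power2_eq_square)
  have w: "(656 / 1000) \<le> w" "w \<le> (78 / 100)" using p q pq by (auto simp: w_def)
  have "2 * (x_bar * q - u * p) * w = (x_bar - u) * ((u + x_bar)\<^sup>2 + w\<^sup>2)"
    using pq(2,3) unfolding w_def by algebra
  also have "\<dots> \<le> (x_bar - u) * ((86 / 10) * w)"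
  proof (rule mult_left_mono)
    have "(u + x_bar)\<^sup>2 \<le> (2 * (10721 / 10000))\<^sup>2" using assms x_bar_bounds by (intro power_mono) auto
    moreover have "w * w \<le> (78 / 100) * w" using w by (intro mult_right_mono) auto
    moreover have "(2 * (10721 / 10000))\<^sup>2 \<le> ((46 / 10) :: real)" by (simp add: power2_eq_square)
    ultimately show "(u + x_bar)\<^sup>2 + w\<^sup>2 \<le> (86 / 10) * w" using w unfolding power2_eq_square[of w] by linarith
  qed (use assms in auto)
  finally have "(x_bar * q - u * p) * (2 * w) \<le> ((43 / 10) * (x_bar - u)) * (2 * w)" by (simp add: algebra_simps)
  then have "x_bar * q - u * p \<le> (43 / 10) * (x_bar - u)" using w by simp
  then show ?thesis unfolding short_reach_def p_def[symmetric] q_def[symmetric] by argo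
qed simp

text \<open>The graph of \<open>short_reach\<close> starts vertically at \<open>1\<close>, like \<open>1 - sqrt (2 * h)\<close>. The bound on \<open>h\<close> is half of
\<open>x_bar - 1\<close>, rounded up.\<close>

lemma short_reach_after_one:
  assumes "0 \<le> h" "h \<le> (361 / 10000)" shows "short_reach (1 + h) \<le> 1 - (64 / 10) * h"
proof -
  have "(74 / 10) * h \<le> sqrt (2 * h)"
  proof (rule real_le_rsqrt)
    have "((74 / 10) * h)\<^sup>2 = (5476 / 100) * h * h" by (simp add: power2_eq_square)
    also have "\<dots> \<le> (5476 / 100) * h * (361 / 10000)" using assms by (intro mult_left_mono) auto
    finally show "((74 / 10) * h)\<^sup>2 \<le> 2 * h" using assms by simp
  qed
  also have "\<dots> \<le> sqrt ((1 + h)\<^sup>2 - 1)" using assms by (simp add: power2_sum)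
  finally have "(74 / 10) * h \<le> sqrt ((1 + h)\<^sup>2 - 1)" .
  then have "1 * ((74 / 10) * h) \<le> (1 + h) * sqrt ((1 + h)\<^sup>2 - 1)" using assms by (intro mult_mono) auto
  then show ?thesis by (simp add: short_reach_def)
qed

text \<open>The reaches \<open>v2\<close> and \<open>u3\<close> share the side opposite to the one with the spare segment. If \<open>u3 \<ge> x_bar\<close>, then
\<open>u0\<close> has to be \<open>sqrt 2\<close>, which leaves \<open>v0 = 0\<close>, while \<open>v2 > 1\<close> makes \<open>u1\<close> smaller than \<open>short_reach x_bar\<close>. If \<open>u3\<close> stays below
\<open>x_bar\<close> by \<open>h\<close>, then \<open>v2\<close> exceeds \<open>1\<close> by at least \<open>h\<close>. Because \<open>short_reach\<close> is so steep at \<open>1\<close>, the reach \<open>u1\<close>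
then falls below \<open>short_reach x_bar\<close> by more than \<open>11 * h\<close>, while \<open>v0\<close> is at most \<open>6.6 * h\<close>; together they
are too short for the side with the spare segment.\<close>

lemma both_long_impossible:
  assumes s: "a_bar \<le> s"
    and K: "(u0, v0) \<in> corner_reach" "(u1, v1) \<in> corner_reach" "(u2, v2) \<in> corner_reach" "(u3, v3) \<in> corner_reach"
    and ineq: "s \<le> v0 + sqrt 2 + u1" "s \<le> v1 + u2" "s \<le> v2 + u3" "s \<le> v3 + u0"
    and w: "1 < v2" "v2 \<le> u3"
  shows False
proof -
  note xb = x_bar_bounds and r2 = sqrt2_bounds
  have a: "a_bar = 1 + x_bar" by (simp add: a_bar_def)
  have fx: "short_reach x_bar = 1 + x_bar - sqrt 2" using short_reach_x_bar by (simp add: a)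
  note nn = corner_reach_nonneg[OF K(1)] corner_reach_nonneg[OF K(2)] corner_reach_nonneg[OF K(3)] corner_reach_nonneg[OF K(4)]
  have u2: "u2 \<le> short_reach v2" using corner_reach_long[of v2 u2] K(3) w corner_reach_swap by blast
  have f1: "short_reach v2 < 1" using short_reach_strict_antimono[of 1 v2] w by simp
  have v1: "s - short_reach v2 \<le> v1" using u2 ineq by linarith
  then have v1': "x_bar < v1" using f1 s a by linarith
  then have u1: "u1 \<le> short_reach v1" using corner_reach_long[of v1 u1] K(2)[THEN corner_reach_swap[THEN iffD1]] xb by linarith
  have v3: "v3 \<le> short_reach u3" using corner_reach_long[OF K(4)] w by linarith
  have u0: "s - short_reach u3 \<le> u0" using v3 ineq by linarith
  show False
  proof (cases "x_bar \<le> u3")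
    case True
    have "short_reach u3 \<le> short_reach x_bar" using short_reach_antimono[of x_bar u3] True xb by linarith
    then have u0': "sqrt 2 \<le> u0" using u0 s a fx by linarith
    then have "v0 \<le> short_reach u0" using corner_reach_long[OF K(1)] r2 by linarith
    also have "\<dots> \<le> short_reach (sqrt 2)" using short_reach_antimono[of "sqrt 2" u0] u0' r2 by linarith
    finally have "v0 \<le> 0" by simp
    moreover have "short_reach v1 < short_reach x_bar"
      using short_reach_strict_antimono[of x_bar v1] v1' xb by linarith
    ultimately show False using u1 ineq(1) s a fx by linarith
  next
    case False
    define h where "h = x_bar - u3"
    have h: "0 < h" "h \<le> (361 / 10000)" using False w ineq(3) s a xb by (auto simp: h_def)
    have "short_reach u3 \<le> short_reach x_bar + (33 / 10) * h"
      unfolding h_def by (rule short_reach_before_x_bar) (use False w ineq(3) s a xb in auto)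
    then have u0': "sqrt 2 - (33 / 10) * h \<le> u0" using u0 s a fx by linarith
    have u0r: "u0 \<le> sqrt 2" by (rule corner_reach_le_sqrt2[OF K(1)])
    have "v0 \<le> short_reach u0" using corner_reach_long[OF K(1)] u0' h r2 by auto
    also have "\<dots> \<le> 2 * (sqrt 2 - u0)" by (rule short_reach_near_sqrt2) (use u0' u0r h r2 in auto)
    finally have v0: "v0 \<le> (66 / 10) * h" using u0' by argo
    have "short_reach v2 \<le> short_reach (1 + h)"
      by (rule short_reach_antimono) (use h ineq(3) s a in \<open>auto simp: h_def\<close>)
    also have "\<dots> \<le> 1 - (64 / 10) * h" by (rule short_reach_after_one) (use h in auto)
    finally have v1'': "x_bar + (64 / 10) * h \<le> v1" using v1 s a by linarith
    have "(182 / 100) * ((64 / 10) * h) \<le> (2 * sqrt 2 - 1) * (v1 - x_bar)"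
      using v1'' r2 h by (intro mult_mono) auto
    then have "short_reach v1 \<le> short_reach x_bar - (182 / 100) * ((64 / 10) * h)"
      using short_reach_slope[of x_bar v1] v1' xb by linarith
    then show False using u1 v0 ineq(1) s a fx h by linarith
  qed
qed

text \<open>Going around from \<open>v2 \<le> 1\<close>, each bound determines the next one: \<open>u3 \<ge> x_bar\<close>, hence \<open>v3 \<le> short_reach x_bar\<close>,
hence \<open>u0 \<ge> sqrt 2\<close>. That is the largest possible reach, so equality holds throughout.\<close>

lemma one_inner_short:
  assumes s: "a_bar \<le> s"
    and K: "(u0, v0) \<in> corner_reach" "(u1, v1) \<in> corner_reach" "(u2, v2) \<in> corner_reach" "(u3, v3) \<in> corner_reach"
    and ineq: "s \<le> v0 + sqrt 2 + u1" "s \<le> v1 + u2" "s \<le> v2 + u3" "s \<le> v3 + u0"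
    and w: "v2 \<le> 1"
  shows "s = a_bar \<and> u0 = sqrt 2 \<and> v0 = 0 \<and> u1 = short_reach x_bar \<and> v1 = x_bar \<and> u2 = 1 \<and> v2 = 1 \<and>
    u3 = x_bar \<and> v3 = short_reach x_bar"
proof -
  note xb = x_bar_bounds and r2 = sqrt2_bounds
  have a: "a_bar = 1 + x_bar" by (simp add: a_bar_def)
  have fx: "short_reach x_bar = 1 + x_bar - sqrt 2" using short_reach_x_bar by (simp add: a)
  note nn = corner_reach_nonneg[OF K(1)] corner_reach_nonneg[OF K(2)] corner_reach_nonneg[OF K(3)] corner_reach_nonneg[OF K(4)]
  have u3: "x_bar \<le> u3" using ineq(3) w s a by linarith
  have v3: "v3 \<le> short_reach u3" using corner_reach_long[OF K(4)] u3 xb by linarith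
  have f3: "short_reach u3 \<le> short_reach x_bar" using short_reach_antimono[of x_bar u3] u3 xb by linarith
  have "u0 \<le> sqrt 2" by (rule corner_reach_le_sqrt2[OF K(1)])
  then have eq: "s = a_bar" "u0 = sqrt 2" "v3 = short_reach x_bar" "short_reach u3 = short_reach x_bar"
    using ineq(4) v3 f3 s a fx by linarith+
  have u3': "u3 = x_bar" using short_reach_strict_antimono[of x_bar u3] u3 xb eq(4) by force
  then have v2: "v2 = 1" using ineq(3) w eq(1) a by linarith
  have "v0 \<le> short_reach (sqrt 2)" using corner_reach_long[OF K(1)] eq(2) r2 by auto
  then have v0: "v0 = 0" using nn by simp
  have u2: "u2 \<le> 1" using corner_reach_sum(1)[OF K(3)] v2 by linarith
  then have v1: "x_bar \<le> v1" using ineq(2) eq(1) a by linarith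
  have u1: "u1 \<le> short_reach v1" using corner_reach_long[of v1 u1] K(2)[THEN corner_reach_swap[THEN iffD1]] v1 xb by linarith
  have u1': "short_reach x_bar \<le> u1" using ineq(1) v0 eq(1) a fx by linarith
  then have v1': "v1 = x_bar" using short_reach_strict_antimono[of x_bar v1] v1 u1 xb by force
  have "u1 = short_reach x_bar" using u1 u1' v1' by simp
  moreover have "u2 = 1" using ineq(2) v1' eq(1) a u2 by linarith
  ultimately show ?thesis using eq u3' v2 v0 v1' by simp
qed

text \<open>Reflection in the perpendicular bisector of the side with the spare segment exchanges the corners \<open>0\<close> and \<open>1\<close>, the
corners \<open>2\<close> and \<open>3\<close>, and the two reaches at each corner; it accounts for the two alternatives and leaves
only two cases to be treated.\<close>

theorem one_segment_rigidity:
  assumes s: "a_bar \<le> s"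
    and K: "(u0, v0) \<in> corner_reach" "(u1, v1) \<in> corner_reach" "(u2, v2) \<in> corner_reach" "(u3, v3) \<in> corner_reach"
    and ineq: "s \<le> v0 + sqrt 2 + u1" "s \<le> v1 + u2" "s \<le> v2 + u3" "s \<le> v3 + u0"
  shows "s = a_bar \<and>
    (u0 = sqrt 2 \<and> v0 = 0 \<and> u1 = short_reach x_bar \<and> v1 = x_bar \<and> u2 = 1 \<and> v2 = 1 \<and>
      u3 = x_bar \<and> v3 = short_reach x_bar \<or>
     v1 = sqrt 2 \<and> u1 = 0 \<and> v0 = short_reach x_bar \<and> u0 = x_bar \<and> v3 = 1 \<and> u3 = 1 \<and>
      v2 = x_bar \<and> u2 = short_reach x_bar)"
proof -
  have K': "(v0, u0) \<in> corner_reach" "(v1, u1) \<in> corner_reach" "(v2, u2) \<in> corner_reach" "(v3, u3) \<in> corner_reach"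
    using K corner_reach_swap by blast+
  have ineq': "s \<le> u1 + sqrt 2 + v0" "s \<le> u0 + v3" "s \<le> u3 + v2" "s \<le> u2 + v1" using ineq by linarith+
  consider "v2 \<le> 1" | "u3 \<le> 1" | "1 < v2" "v2 \<le> u3" | "1 < u3" "u3 \<le> v2" by linarith
  then show ?thesis
  proof cases
    case 1 then show ?thesis using one_inner_short[OF s K ineq] by blast
  next
    case 2 then show ?thesis using one_inner_short[OF s K'(2,1,4,3) ineq'] by blast
  next
    case 3 then show ?thesis using both_long_impossible[OF s K ineq] by blast
  next
    case 4 then show ?thesis using both_long_impossible[OF s K'(2,1,4,3) ineq'] by blast
  qed
qed

section \<open>Five unit squares\<close>

lemma reach_scheme_5_a_bar: "reach_scheme 5 a_bar"
  unfolding reach_scheme_iff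
proof (intro bexI)
  let ?f = "short_reach x_bar"
  have "?f = 1 + x_bar - sqrt 2" using short_reach_x_bar by (simp add: a_bar_def)
  then show "a_bar \<le> scheme_length (1, 0, 0, 0) ((sqrt 2, 0), (?f, x_bar), (1, 1), (x_bar, ?f))"
    by (simp add: scheme_length_def a_bar_def)
  have "0 \<le> ?f" using \<open>?f = 1 + x_bar - sqrt 2\<close> x_bar_bounds sqrt2_bounds by linarith
  then show "((sqrt 2, 0), (?f, x_bar), (1, 1), (x_bar, ?f)) \<in> reach_configurations"
    using x_bar_bounds by (simp add: corner_reach_def)
  show "(1, 0, 0, 0) \<in> segment_distributions 5" by (simp add: segment_distributions_def)
qed

lemma reach_scheme_5_bound: assumes "reach_scheme 5 s" shows "s \<le> a_bar"
proof (rule ccontr)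
  assume "\<not> s \<le> a_bar"
  then have s: "a_bar \<le> s" "s \<noteq> a_bar" by auto
  obtain r q :: "nat \<Rightarrow> real" and k :: "nat \<Rightarrow> nat" where r4: "r 4 = r 0"
    and rq: "\<forall>i<4. (r i, q i) \<in> corner_reach \<and> s \<le> q i + k i * sqrt 2 + r (Suc i)"
    and n: "(4::nat) + sum k {..<4} \<le> 5"
    using assms unfolding reach_scheme_def by blast
  have K: "(r 0, q 0) \<in> corner_reach" "(r 1, q 1) \<in> corner_reach" "(r 2, q 2) \<in> corner_reach" "(r 3, q 3) \<in> corner_reach"
    using rq by (simp_all add: all_less_4)
  have L: "s \<le> q 0 + k 0 * sqrt 2 + r 1" "s \<le> q 1 + k 1 * sqrt 2 + r 2" "s \<le> q 2 + k 2 * sqrt 2 + r 3" "s \<le> q 3 + k 3 * sqrt 2 + r 0"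
    using rq r4 by (simp_all add: all_less_4 numeral_2_eq_2[symmetric])
  have "k 0 + k 1 + k 2 + k 3 \<le> 1" using n by (simp add: sum_less_4)
  then have "k 0 = 0 \<or> k 1 + k 2 + k 3 = 0" "k 1 = 0 \<or> k 2 + k 3 = 0" "k 2 = 0 \<or> k 3 = 0"
    "k 0 \<le> 1" "k 1 \<le> 1" "k 2 \<le> 1" "k 3 \<le> 1" by linarith+
  then consider "k 0 \<le> 1" "k 1 = 0" "k 2 = 0" "k 3 = 0" | "k 1 = 1" "k 0 = 0" "k 2 = 0" "k 3 = 0"
    | "k 2 = 1" "k 0 = 0" "k 1 = 0" "k 3 = 0" | "k 3 = 1" "k 0 = 0" "k 1 = 0" "k 2 = 0" by (auto simp: le_Suc_eq)
  then show False
  proof cases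
    case 1
    then have "real (k 0) * sqrt 2 \<le> sqrt 2" by (simp add: mult_left_le_one_le)
    then have "s \<le> q 0 + sqrt 2 + r 1" using L by linarith
    then show False using one_segment_rigidity[OF s(1) K(1,2,3,4)] L 1 s(2) by simp
  next
    case 2 then show False using one_segment_rigidity[OF s(1) K(2,3,4,1)] L s(2) by simp
  next
    case 3 then show False using one_segment_rigidity[OF s(1) K(3,4,1,2)] L s(2) by simp
  next
    case 4 then show False using one_segment_rigidity[OF s(1) K(4,1,2,3)] L s(2) by simp
  qed
qed

theorem S_bd_5: "S_bd 5 = a_bar"
  using S_bd_maximum[of 5] reach_scheme_5_a_bar reach_scheme_5_bound by (simp add: antisym)

lemma plane_isometry_rotation: "plane_isometry (\<lambda>p. rotation \<phi> p + v)"
proof -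
  have "(cos \<phi> * a - sin \<phi> * b)\<^sup>2 + (sin \<phi> * a + cos \<phi> * b)\<^sup>2 = a\<^sup>2 + b\<^sup>2" for a b
  proof -
    have "(cos \<phi> * a - sin \<phi> * b)\<^sup>2 + (sin \<phi> * a + cos \<phi> * b)\<^sup>2 = ((sin \<phi>)\<^sup>2 + (cos \<phi>)\<^sup>2) * (a\<^sup>2 + b\<^sup>2)"
      by algebra
    then show ?thesis by simp
  qed
  from this[of "p$1 - q$1" "p$2 - q$2" for p q :: "real^2"] show ?thesis
    by (simp add: plane_isometry_def dist_plane rotation_def algebra_simps)
qed

lemma short_reach_x_bar_pos: "0 < short_reach x_bar" "short_reach x_bar < 1"
  using short_reach_x_bar x_bar_bounds sqrt2_bounds unfolding a_bar_def by linarith+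

lemma tilted_square_unit: "is_square 1 tilted_square"
  unfolding tilted_square_def
  by (intro is_square_isometry plane_isometry_rotation is_square_axis_square) simp

text \<open>The three points that determine the square: the corner \<open>(a_bar, 0)\<close> of the big square and the ends of the two chords
from there. Their preimages in \<open>[0, 1]\<^sup>2\<close> are \<open>(1, x_bar * d)\<close>, the origin and \<open>(1 - f * d, 1)\<close>, where
\<open>d = sin theta_bar\<close> and \<open>f = short_reach x_bar\<close>.\<close>

lemma tilted_square_mem:
  "pt 1 0 \<in> tilted_square" "pt a_bar 0 \<in> tilted_square" "pt a_bar (short_reach x_bar) \<in> tilted_square"
proof -
  define c d f where "c = cos theta_bar" and "d = sin theta_bar" and "f = short_reach x_bar"
  note xb = x_bar_bounds
  have ran: "-1 \<le> 1 / x_bar" "1 / x_bar \<le> 1" using xb by (auto simp: field_simps)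
  then have c: "c = 1 / x_bar" by (simp add: c_def theta_bar_def cos_arccos)
  have d: "d = sqrt (1 - (1 / x_bar)\<^sup>2)" using ran by (simp add: d_def theta_bar_def sin_arccos)
  have x2: "1 \<le> x_bar\<^sup>2" using xb by simp
  have "x_bar * d = sqrt (x_bar\<^sup>2 * (1 - (1 / x_bar)\<^sup>2))" using xb by (simp add: d real_sqrt_mult)
  also have "x_bar\<^sup>2 * (1 - (1 / x_bar)\<^sup>2) = x_bar\<^sup>2 - 1" using xb by (simp add: field_simps)
  finally have xd: "x_bar * d = sqrt (x_bar\<^sup>2 - 1)" .
  have xc: "x_bar * c = 1" using xb by (simp add: c)
  have cd: "c\<^sup>2 + d\<^sup>2 = 1" by (simp add: c_def d_def)
  have "(1 / x_bar)\<^sup>2 \<le> 1" using ran by (simp add: abs_square_le_1)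
  then have "0 \<le> d" unfolding d by (intro real_sqrt_ge_zero) simp
  then have d0: "0 \<le> d" "d \<le> 1" by (auto simp: d_def)
  have fx: "f = x_bar - x_bar * (x_bar * d)" by (simp add: f_def short_reach_def xd)
  have f: "0 < f" "f < 1" using short_reach_x_bar_pos by (auto simp: f_def)
  have mem: "pt (1 + (c * y + d * z)) (c * z - d * y) \<in> tilted_square"
    if "0 \<le> y" "y \<le> 1" "0 \<le> z" "z \<le> 1" for y z
  proof -
    have "pt y z \<in> axis_square 1" using that by (simp add: axis_square_def mem_box_cart forall_2)
    moreover have "rotation (- theta_bar) (pt y z) + vector [1, 0] = pt (1 + (c * y + d * z)) (c * z - d * y)"
      by (simp add: rotation_def pt_eq_iff c_def d_def)
    ultimately show ?thesis unfolding tilted_square_def by (metis image_eqI)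
  qed
  show "pt 1 0 \<in> tilted_square" using mem[of 0 0] by simp
  have "x_bar * (x_bar * d) < x_bar * 1" using fx f by linarith
  then have xd1: "x_bar * d \<le> 1" using x_bar_pos by (simp only: mult_less_cancel_left_pos less_imp_le)
  have xd0: "0 \<le> x_bar * d" using d0 xb by simp
  have "c * (x_bar * d) = x_bar * c * d" by simp
  then have cxd: "c * (x_bar * d) - d * 1 = 0" by (simp add: xc)
  have "d * (x_bar * d) = x_bar * d\<^sup>2" by (simp add: power2_eq_square)
  also have "d\<^sup>2 = 1 - c\<^sup>2" using cd by simp
  also have "x_bar * (1 - c\<^sup>2) = x_bar - x_bar * c * c" by (simp add: power2_eq_square algebra_simps)
  finally have dxd: "c * 1 + d * (x_bar * d) = x_bar" by (simp add: xc)
  show "pt a_bar 0 \<in> tilted_square" 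
    using mem[of 1 "x_bar * d", unfolded cxd dxd] xd0 xd1 by (simp add: a_bar_def)
  have "f * d \<le> 1 * 1" using f d0 by (intro mult_mono) auto
  then have fd: "0 \<le> 1 - f * d" "1 - f * d \<le> 1" using f d0 by auto
  have "c * f = x_bar * c - x_bar * c * (x_bar * d)" by (simp add: fx algebra_simps)
  then have cf: "c * f = 1 - x_bar * d" by (simp add: xc)
  have "c * (1 - f * d) + d * 1 = c - c * f * d + d" by (simp add: algebra_simps)
  also have "\<dots> = c * 1 + d * (x_bar * d)" by (simp add: cf algebra_simps)
  also have "\<dots> = x_bar" by (rule dxd)
  finally have one: "c * (1 - f * d) + d * 1 = x_bar" .
  have "c * 1 - d * (1 - f * d) = c - d + f * d\<^sup>2" by (simp add: power2_eq_square algebra_simps)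
  also have "d\<^sup>2 = 1 - c\<^sup>2" using cd by simp
  also have "c - d + f * (1 - c\<^sup>2) = c - d + f - c * (c * f)" by (simp add: power2_eq_square algebra_simps)
  also have "\<dots> = f" using cxd by (simp add: cf algebra_simps)
  finally have two: "c * 1 - d * (1 - f * d) = f" .
  show "pt a_bar (short_reach x_bar) \<in> tilted_square"
    using fd mem[of "1 - f * d" 1, unfolded one two] by (simp add: a_bar_def f_def)
qed

text \<open>A reflection puts the corner \<open>(a_bar, 0)\<close> at the origin, where the square with these chords is unique.\<close>

lemma tilted_square_unique:
  assumes Q: "is_square 1 Q" and mem: "pt 1 0 \<in> Q" "pt a_bar 0 \<in> Q" "pt a_bar (short_reach x_bar) \<in> Q"
  shows "Q = tilted_square"
proof -
  let ?h = "\<lambda>z::real^2. pt (a_bar - z$1) (z$2)"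
  let ?R = "frame_square (1 / x_bar) (sqrt (x_bar\<^sup>2 - 1) / x_bar) 0 (- sqrt (x_bar\<^sup>2 - 1))"
  have h: "plane_isometry ?h" by (simp add: plane_isometry_def dist_plane power2_commute)
  have *: "?h ` P = ?R" if P: "is_square 1 P" "pt 1 0 \<in> P" "pt a_bar 0 \<in> P" "pt a_bar (short_reach x_bar) \<in> P" for P
  proof (rule unit_square_corner_unique)
    show "is_square 1 (?h ` P)" using is_square_isometry[OF h P(1)] .
    show "1 < x_bar" using x_bar_bounds by linarith
    show "0 \<le> short_reach x_bar" using short_reach_x_bar_pos by simp
    show "pt 0 0 \<in> ?h ` P" "pt x_bar 0 \<in> ?h ` P" "pt 0 (short_reach x_bar) \<in> ?h ` P"
      using imageI[OF P(2), of ?h] imageI[OF P(3), of ?h] imageI[OF P(4), of ?h] by (simp_all add: a_bar_def)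
  qed
  have "?h ` Q = ?h ` tilted_square" using *[OF Q mem] *[OF tilted_square_unit tilted_square_mem] by simp
  then show ?thesis by (simp only: inj_image_eq_iff[OF bij_is_inj[OF plane_isometry_bij[OF h]]])
qed

lemma tilted_square_swap_unique:
  assumes Q: "is_square 1 Q" and mem: "pt 0 1 \<in> Q" "pt 0 a_bar \<in> Q" "pt (short_reach x_bar) a_bar \<in> Q"
  shows "Q = (\<lambda>p. vector [p$2, p$1]) ` tilted_square"
proof -
  let ?h = "\<lambda>z::real^2. pt (z$2) (z$1)"
  have "?h ` Q = tilted_square"
  proof (rule tilted_square_unique)
    show "is_square 1 (?h ` Q)" using is_square_isometry[OF plane_isometry_swap Q] .
    show "pt 1 0 \<in> ?h ` Q" "pt a_bar 0 \<in> ?h ` Q" "pt a_bar (short_reach x_bar) \<in> ?h ` Q"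
      using imageI[OF mem(1), of ?h] imageI[OF mem(2), of ?h] imageI[OF mem(3), of ?h] by simp_all
  qed
  moreover have "?h ` ?h ` Q = Q" by (simp add: image_image)
  ultimately show ?thesis by simp
qed

text \<open>Two points of a unit square at distance \<open>sqrt 2\<close> are opposite vertices. In coordinates along the diagonal and
perpendicular to it, the square is a ball of the \<open>1\<close>-norm.\<close>

lemma unit_square_diamond:
  assumes Q: "is_square 1 Q" and mem: "p \<in> Q" "q \<in> Q" and pq: "dist p q = sqrt 2"
  defines "e \<equiv> q - p" and "m \<equiv> midpoint p q"
  shows "Q = {z. \<bar>(z$1 - m$1) * e$1 + (z$2 - m$2) * e$2\<bar> + \<bar>(z$2 - m$2) * e$1 - (z$1 - m$1) * e$2\<bar> \<le> 1}"
proof -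
  obtain c d a b where cd: "c\<^sup>2 + d\<^sup>2 = 1" and Qf: "Q = frame_square c d a b"
    using unit_square_frame[OF Q] by metis
  define X Y where "X = c * e$1 + d * e$2" and "Y = c * e$2 - d * e$1"
  have m: "m$1 = (p$1 + q$1) / 2" "m$2 = (p$2 + q$2) / 2" by (simp_all add: m_def midpoint_def)
  define mx my where "mx = c * m$1 + d * m$2" and "my = c * m$2 - d * m$1"
  have coords: "a \<le> mx - X / 2" "mx - X / 2 \<le> a + 1" "a \<le> mx + X / 2" "mx + X / 2 \<le> a + 1"
    "b \<le> my - Y / 2" "my - Y / 2 \<le> b + 1" "b \<le> my + Y / 2" "my + Y / 2 \<le> b + 1"
  proof -
    have "mx - X / 2 = c * p$1 + d * p$2" "mx + X / 2 = c * q$1 + d * q$2"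
      "my - Y / 2 = c * p$2 - d * p$1" "my + Y / 2 = c * q$2 - d * q$1"
      by (simp_all add: mx_def my_def X_def Y_def m e_def field_simps)
    then show "a \<le> mx - X / 2" "mx - X / 2 \<le> a + 1" "a \<le> mx + X / 2" "mx + X / 2 \<le> a + 1"
      "b \<le> my - Y / 2" "my - Y / 2 \<le> b + 1" "b \<le> my + Y / 2" "my + Y / 2 \<le> b + 1"
      using mem unfolding Qf frame_square_def by simp_all
  qed
  then have abs: "\<bar>X\<bar> \<le> 1" "\<bar>Y\<bar> \<le> 1" by auto
  have "(p$1 - q$1)\<^sup>2 + (p$2 - q$2)\<^sup>2 = 2" using pq unfolding dist_plane by simp
  then have "(c\<^sup>2 + d\<^sup>2) * ((e$1)\<^sup>2 + (e$2)\<^sup>2) = 2" using cd by (simp add: e_def power2_commute)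
  moreover have "(c\<^sup>2 + d\<^sup>2) * ((e$1)\<^sup>2 + (e$2)\<^sup>2) = X\<^sup>2 + Y\<^sup>2" unfolding X_def Y_def by algebra
  moreover have "X\<^sup>2 \<le> 1" "Y\<^sup>2 \<le> 1" using abs by (simp_all add: abs_square_le_1)
  ultimately have "X\<^sup>2 = 1" "Y\<^sup>2 = 1" by linarith+
  then have XY: "X = 1 \<or> X = -1" "Y = 1 \<or> Y = -1" by (auto simp: power2_eq_1_iff)
  then have mid: "mx = a + 1 / 2" "my = b + 1 / 2" using coords by auto
  show ?thesis
  proof (rule set_eqI)
    fix z :: "real^2"
    define Zx Zy where "Zx = c * (z$1 - m$1) + d * (z$2 - m$2)" and "Zy = c * (z$2 - m$2) - d * (z$1 - m$1)"
    have "z \<in> Q \<longleftrightarrow> \<bar>Zx\<bar> \<le> 1 / 2 \<and> \<bar>Zy\<bar> \<le> 1 / 2"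
    proof -
      have "c * z$1 + d * z$2 = mx + Zx" "c * z$2 - d * z$1 = my + Zy"
        by (simp_all add: Zx_def Zy_def mx_def my_def algebra_simps)
      then have "c * z$1 + d * z$2 = a + 1 / 2 + Zx" "c * z$2 - d * z$1 = b + 1 / 2 + Zy"
        unfolding mid .
      then show ?thesis unfolding Qf frame_square_def mem_Collect_eq by (simp only:) linarith
    qed
    also have "\<dots> \<longleftrightarrow> \<bar>Zx * X + Zy * Y\<bar> + \<bar>Zy * X - Zx * Y\<bar> \<le> 1"
      using XY by (elim disjE) (auto simp: abs_if)
    also have "Zx * X + Zy * Y = (c\<^sup>2 + d\<^sup>2) * ((z$1 - m$1) * e$1 + (z$2 - m$2) * e$2)"
      unfolding Zx_def Zy_def X_def Y_def by algebra
    also have "Zy * X - Zx * Y = (c\<^sup>2 + d\<^sup>2) * ((z$2 - m$2) * e$1 - (z$1 - m$1) * e$2)"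
      unfolding Zx_def Zy_def X_def Y_def by algebra
    finally show "z \<in> Q \<longleftrightarrow> z \<in> {z. \<bar>(z$1 - m$1) * e$1 + (z$2 - m$2) * e$2\<bar> + \<bar>(z$2 - m$2) * e$1 - (z$1 - m$1) * e$2\<bar> \<le> 1}"
      using cd by simp
  qed
qed

text \<open>The edges at \<open>p\<close> are the vectors \<open>u\<close> and \<open>v\<close>, obtained from half of the diagonal by turning by \<open>pi / 4\<close> in
either direction and stretching by \<open>sqrt 2\<close>; the hull of the four vertices is a parallelogram.\<close>

lemma square_with_diagonal_unit:
  assumes pq: "dist p q = sqrt 2" shows "is_square 1 (square_with_diagonal p q)"
proof -
  define h1 h2 where "h1 = (q$1 - p$1) / 2" and "h2 = (q$2 - p$2) / 2"
  define u v where "u = pt (h1 + h2) (h2 - h1)" and "v = pt (h1 - h2) (h1 + h2)"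
  have "(p$1 - q$1)\<^sup>2 + (p$2 - q$2)\<^sup>2 = 2" using pq unfolding dist_plane by simp
  then have h: "h1\<^sup>2 + h2\<^sup>2 = 1 / 2" by (simp add: h1_def h2_def power_divide power2_commute field_simps)
  define P where "P = {p + x *\<^sub>R u + y *\<^sub>R v | x y. 0 \<le> x \<and> x \<le> 1 \<and> 0 \<le> y \<and> y \<le> 1}"
  have "(h1 + h2)\<^sup>2 + (h2 - h1)\<^sup>2 = 2 * (h1\<^sup>2 + h2\<^sup>2)" "(h1 - h2)\<^sup>2 + (h1 + h2)\<^sup>2 = 2 * (h1\<^sup>2 + h2\<^sup>2)"
    by algebra+
  then have "norm u = 1" "norm v = 1" "u \<bullet> v = 0"
    using h by (simp_all add: u_def v_def norm_plane inner_plane) (simp add: algebra_simps)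
  then have P: "is_square 1 P" unfolding is_square_def P_def by auto
  have swd: "square_with_diagonal p q = convex hull {p, p + v, p + u + v, p + u}"
  proof -
    have c: "midpoint p q + rotation (pi / 2) (q - midpoint p q) = p + v"
      "midpoint p q - rotation (pi / 2) (q - midpoint p q) = p + u" "q = p + u + v"
      by (simp_all add: pt_eq_iff midpoint_def rotation_def u_def v_def h1_def h2_def field_simps)
    show ?thesis unfolding square_with_diagonal_def Let_def c(1,2) using c(3) by simp
  qed
  have "square_with_diagonal p q = P"
  proof
    have in_P: "p + x *\<^sub>R u + y *\<^sub>R v \<in> P" if "0 \<le> x" "x \<le> 1" "0 \<le> y" "y \<le> 1" for x y
      using that unfolding P_def by blast
    have "{p, p + v, p + u + v, p + u} \<subseteq> P"
      using in_P[of 0 0] in_P[of 0 1] in_P[of 1 1] in_P[of 1 0] by simp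
    then show "square_with_diagonal p q \<subseteq> P"
      unfolding swd by (rule hull_minimal) (rule unit_square_convex[OF P])
    show "P \<subseteq> square_with_diagonal p q"
    proof
      fix z assume "z \<in> P"
      then obtain x y where xy: "0 \<le> x" "x \<le> 1" "0 \<le> y" "y \<le> 1" and z: "z = p + x *\<^sub>R u + y *\<^sub>R v"
        unfolding P_def by blast
      let ?H = "convex hull {p, p + v, p + u + v, p + u}"
      have H: "convex ?H" "p \<in> ?H" "p + v \<in> ?H" "p + u + v \<in> ?H" "p + u \<in> ?H"
        by (auto intro: hull_inc)
      have "(1 - y) *\<^sub>R p + y *\<^sub>R (p + v) \<in> ?H" "(1 - y) *\<^sub>R (p + u) + y *\<^sub>R (p + u + v) \<in> ?H"
        using convexD_alt[OF H(1)] H xy by blast+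
      then have "(1 - x) *\<^sub>R ((1 - y) *\<^sub>R p + y *\<^sub>R (p + v)) + x *\<^sub>R ((1 - y) *\<^sub>R (p + u) + y *\<^sub>R (p + u + v)) \<in> ?H"
        using convexD_alt[OF H(1)] xy by blast
      also have "(1 - x) *\<^sub>R ((1 - y) *\<^sub>R p + y *\<^sub>R (p + v)) + x *\<^sub>R ((1 - y) *\<^sub>R (p + u) + y *\<^sub>R (p + u + v)) = z"
        unfolding z by (simp add: pt_eq_iff algebra_simps)
      finally show "z \<in> square_with_diagonal p q" unfolding swd .
    qed
  qed
  then show ?thesis using P by simp
qed

lemma square_with_diagonal_unique:
  assumes "is_square 1 Q" "p \<in> Q" "q \<in> Q" "dist p q = sqrt 2"
  shows "Q = square_with_diagonal p q"
proof -
  have "p \<in> square_with_diagonal p q" "q \<in> square_with_diagonal p q"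
    by (auto simp: square_with_diagonal_def Let_def intro: hull_inc)
  then show ?thesis
    using unit_square_diamond[OF assms] unit_square_diamond[OF square_with_diagonal_unit[OF assms(4)] _ _ assms(4)]
    by simp
qed

subsection \<open>Uniqueness of the optimal family\<close>

lemma side_pt_closed_ends:
  assumes "closed C" "x < y" "\<And>t. x < t \<Longrightarrow> t < y \<Longrightarrow> side_pt s i t \<in> C"
  shows "side_pt s i x \<in> C" "side_pt s i y \<in> C"
proof -
  have "closed (UNIV \<inter> side_pt s i -` C)"
    by (rule continuous_closed_preimage[OF continuous_side_pt closed_UNIV assms(1)])
  moreover have "{x<..<y} \<subseteq> UNIV \<inter> side_pt s i -` C" using assms(3) by auto
  ultimately have "closure {x<..<y} \<subseteq> UNIV \<inter> side_pt s i -` C" by (rule closure_minimal[rotated])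
  moreover have "x \<in> closure {x<..<y}" "y \<in> closure {x<..<y}" using assms(2) by simp_all
  ultimately show "side_pt s i x \<in> C" "side_pt s i y \<in> C" by blast+
qed

locale five_covering = boundary_covering a_bar 5 F for F
begin

text \<open>Four of the five squares are the chosen ones at the corners; this is the index of the fifth.\<close>

definition extra :: nat where "extra = (SOME m. m < 5 \<and> m \<notin> corner_index ` {..<4})"

lemma indices: "{..<5} = insert extra (corner_index ` {..<4})" and extra_less: "extra < 5"
proof -
  have sub: "corner_index ` {..<4} \<subseteq> {..<5}" using corner_index(1) by auto
  have card: "card (corner_index ` {..<4}) = 4" by (simp add: card_image inj_corner_index)
  have "\<exists>m. m < 5 \<and> m \<notin> corner_index ` {..<4}"
  proof (rule ccontr)
    assume "\<not> ?thesis"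
    then have "{..<5} \<subseteq> corner_index ` {..<4}" by auto
    then have "card {..<5::nat} \<le> card (corner_index ` {..<4})" by (intro card_mono) auto
    then show False using card by simp
  qed
  then have m: "extra < 5 \<and> extra \<notin> corner_index ` {..<4}" unfolding extra_def by (rule someI_ex)
  then show "extra < 5" by simp
  have "insert extra (corner_index ` {..<4}) = {..<5}"
    by (rule card_subset_eq) (use sub card m in auto)
  then show "{..<5} = insert extra (corner_index ` {..<4})" by simp
qed

lemma extra_unit: "is_square 1 (F extra)"
  by (rule unitD[OF extra_less])

lemma side_cases:
  assumes "0 \<le> t" "t \<le> a_bar"
  shows "t \<le> out_reach i \<or> a_bar - t \<le> in_reach (Suc i) \<or> side_pt a_bar i t \<in> F extra"
proof (rule side_cover_cases[OF assms, of i])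
  fix m assume m: "m < 5" "m \<notin> corner_index ` {..<4}" "side_pt a_bar i t \<in> F m"
  have "m \<in> insert extra (corner_index ` {..<4})" unfolding indices[symmetric] using m(1) by simp
  then show ?thesis using m by blast
qed auto

lemma gap_point:
  assumes "out_reach i < t" "t < a_bar - in_reach (Suc i)"
  shows "side_pt a_bar i t \<in> F extra"
proof -
  have "0 \<le> t" "t \<le> a_bar" using assms reach_nonneg[of i] reach_nonneg[of "Suc i"] by auto
  then show ?thesis using side_cases[of t i] assms by linarith
qed

lemma side_without_extra:
  assumes "\<not> meets_side a_bar (F extra) i" shows "a_bar \<le> out_reach i + in_reach (Suc i)"
proof (rule ccontr)
  assume "\<not> ?thesis"
  then obtain t where t: "out_reach i < t" "t < a_bar - in_reach (Suc i)"
    using dense[of "out_reach i" "a_bar - in_reach (Suc i)"] by auto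
  then have "0 \<le> t" "t \<le> a_bar" using reach_nonneg[of i] reach_nonneg[of "Suc i"] by auto
  then show False using gap_point[OF t] assms unfolding meets_side_def by blast
qed

lemma side_with_extra: "a_bar \<le> out_reach i + sqrt 2 + in_reach (Suc i)"
proof (rule ccontr)
  let ?x = "out_reach i" and ?y = "a_bar - in_reach (Suc i)"
  assume "\<not> ?thesis"
  then have xy: "?x + sqrt 2 < ?y" by simp
  then have "?x < ?y" using sqrt2_bounds by linarith
  then have "side_pt a_bar i ?x \<in> F extra" "side_pt a_bar i ?y \<in> F extra"
    using side_pt_closed_ends[OF unit_square_closed[OF extra_unit], of ?x ?y a_bar i] gap_point by blast+
  then have "\<bar>?x - ?y\<bar> \<le> sqrt 2"
    using unit_square_diameter[OF extra_unit] dist_side_pt by metis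
  then show False using xy by linarith
qed

lemma in_reach_le: "in_reach i \<le> sqrt 2" and out_reach_le: "out_reach i \<le> sqrt 2"
  and reach_mem: "(in_reach i, out_reach i) \<in> corner_reach"
  using exact_reach[of i] corner_reach_le_sqrt2 unfolding exact_reach_def by blast+

lemma reach_of_Suc3: "reach_of (Suc (i + 3)) = reach_of i"
  using reach_of_plus4[of i] by (simp add: eval_nat_numeral)

text \<open>If the fifth square meets both sides at corner \<open>i\<close>, then it and the corner square stay within \<open>sqrt 2\<close> of the
corner, so the pair may be treated like a corner square with reach \<open>(sqrt 2, 0)\<close> and a spare segment on side \<open>i\<close>.\<close>

lemma extra_at_corner:
  assumes "meets_side a_bar (F extra) i" "meets_side a_bar (F extra) (i + 3)"
  shows "a_bar \<le> sqrt 2 + in_reach (Suc i)" "a_bar \<le> out_reach (i + 3) + sqrt 2"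
proof -
  obtain t1 where t1: "side_pt a_bar i t1 \<in> F extra" using assms(1) unfolding meets_side_def by blast
  obtain t2 where t2: "side_pt a_bar (i + 3) t2 \<in> F extra" using assms(2) unfolding meets_side_def by blast
  have near: "t \<le> sqrt 2" if "side_pt a_bar i t \<in> F extra" for t
    using adjacent_reach(2)[OF extra_unit t2, of t] that side_pt_Suc3 by simp
  have near': "a_bar - t \<le> sqrt 2" if "side_pt a_bar (i + 3) t \<in> F extra" for t
    using adjacent_reach(1)[OF extra_unit that, of t1] t1 side_pt_Suc3 by simp
  show "a_bar \<le> sqrt 2 + in_reach (Suc i)"
  proof (rule ccontr)
    assume "\<not> ?thesis"
    then obtain t where t: "sqrt 2 < t" "t < a_bar - in_reach (Suc i)"
      using dense[of "sqrt 2" "a_bar - in_reach (Suc i)"] by auto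
    then have "out_reach i < t" using out_reach_le[of i] by linarith
    then show False using gap_point[OF _ t(2)] near[of t] t(1) by simp
  qed
  show "a_bar \<le> out_reach (i + 3) + sqrt 2"
  proof (rule ccontr)
    assume "\<not> ?thesis"
    then obtain t where t: "out_reach (i + 3) < t" "t < a_bar - sqrt 2"
      using dense[of "out_reach (i + 3)" "a_bar - sqrt 2"] by auto
    then have "t < a_bar - in_reach (Suc (i + 3))" using in_reach_le[of "Suc (i + 3)"] by linarith
    then show False using gap_point[OF t(1)] near'[of t] t(2) by simp
  qed
qed

lemma extra_position:
  obtains i where "\<And>j. j \<in> {1, 2, 3} \<Longrightarrow> \<not> meets_side a_bar (F extra) (i + j)"
  | i where "meets_side a_bar (F extra) i" "meets_side a_bar (F extra) (i + 3)"
      "\<not> meets_side a_bar (F extra) (i + 1)" "\<not> meets_side a_bar (F extra) (i + 2)"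
proof -
  let ?M = "meets_side a_bar (F extra)"
  have opp: "\<not> ?M (i + 2)" if "?M i" for i by (rule meets_side_opposite[OF long extra_unit that])
  have per: "?M (i + 4) = ?M i" for i by (rule meets_side_plus4)
  show ?thesis
  proof (cases "\<exists>a. ?M a")
    case False then show ?thesis using that(1)[of 0] by blast
  next
    case True
    then obtain a where a: "?M a" by blast
    have e: "a + 1 + 3 = a + 4" "a + 3 + 2 = a + 1 + 4" by simp_all
    consider "?M (a + 3)" | "?M (a + 1)" | "\<not> ?M (a + 1)" "\<not> ?M (a + 3)" by blast
    then show ?thesis
    proof cases
      case 1
      have "\<not> ?M (a + 1)" using opp[OF 1] per[of "a + 1"] unfolding e by simp
      then show ?thesis using that(2)[of a] a 1 opp[OF a] by blast
    next
      case 2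
      have "?M (a + 1 + 3)" using a per[of a] unfolding e by simp
      moreover have "\<not> ?M (a + 1 + 2)" by (rule opp[OF 2])
      moreover have "\<not> ?M (a + 1 + 1)" using opp[OF a] by simp
      ultimately show ?thesis using that(2)[of "a + 1"] 2 by blast
    next
      case 3 then show ?thesis using that(1)[of a] opp[OF a] by blast
    qed
  qed
qed

text \<open>The special corner \<open>p\<close> is the one whose reach is \<open>(sqrt 2, 0)\<close> or \<open>(0, sqrt 2)\<close> in the scheme. If the fifth square
meets both sides at corner \<open>i\<close>, only the first alternative of the rigidity theorem is possible, because
the reach assigned to this corner was \<open>(sqrt 2, 0)\<close>.\<close>

lemma special_corner:
  obtains p where "reach_of (p + 1) = (short_reach x_bar, x_bar)" "reach_of (p + 2) = (1, 1)"
    "reach_of (p + 3) = (x_bar, short_reach x_bar)"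
proof (cases rule: extra_position)
  case (1 i)
  have L: "a_bar \<le> out_reach i + sqrt 2 + in_reach (i + 1)" "a_bar \<le> out_reach (i + 1) + in_reach (i + 2)"
    "a_bar \<le> out_reach (i + 2) + in_reach (i + 3)" "a_bar \<le> out_reach (i + 3) + in_reach i"
    using side_with_extra[of i] side_without_extra[OF 1[of 1]] side_without_extra[OF 1[of 2]]
      side_without_extra[OF 1[of 3]] reach_of_Suc3[of i] by (simp_all add: eval_nat_numeral)
  note rig = one_segment_rigidity[OF order_refl reach_mem[of i] reach_mem[of "i + 1"] reach_mem[of "i + 2"] reach_mem[of "i + 3"] L]
  then consider "in_reach (i + 1) = short_reach x_bar" "out_reach (i + 1) = x_bar" "in_reach (i + 2) = 1" "out_reach (i + 2) = 1"
      "in_reach (i + 3) = x_bar" "out_reach (i + 3) = short_reach x_bar"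
    | "out_reach i = short_reach x_bar" "in_reach i = x_bar" "out_reach (i + 3) = 1" "in_reach (i + 3) = 1"
      "out_reach (i + 2) = x_bar" "in_reach (i + 2) = short_reach x_bar" by blast
  then show ?thesis
  proof cases
    case 1
    then show ?thesis using that[of i] by (simp add: prod_eq_iff)
  next
    case 2
    have "reach_of (i + 1 + 3) = reach_of i" using reach_of_plus4[of i] by (simp add: eval_nat_numeral)
    then show ?thesis using that[of "i + 1"] 2 by (simp add: prod_eq_iff eval_nat_numeral)
  qed
next
  case (2 i)
  have K: "(sqrt 2, 0) \<in> corner_reach" by (simp add: corner_reach_def)
  have L: "a_bar \<le> 0 + sqrt 2 + in_reach (i + 1)" "a_bar \<le> out_reach (i + 1) + in_reach (i + 2)"
    "a_bar \<le> out_reach (i + 2) + in_reach (i + 3)" "a_bar \<le> out_reach (i + 3) + sqrt 2"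
    using extra_at_corner[OF 2(1,2)] side_without_extra[OF 2(3)] side_without_extra[OF 2(4)]
    by (simp_all add: eval_nat_numeral)
  note rig = one_segment_rigidity[OF order_refl K reach_mem[of "i + 1"] reach_mem[of "i + 2"] reach_mem[of "i + 3"] L]
  have "sqrt 2 \<noteq> x_bar" using sqrt2_bounds x_bar_bounds by linarith
  then have "in_reach (i + 1) = short_reach x_bar \<and> out_reach (i + 1) = x_bar \<and> in_reach (i + 2) = 1 \<and> out_reach (i + 2) = 1 \<and>
      in_reach (i + 3) = x_bar \<and> out_reach (i + 3) = short_reach x_bar" using rig by blast
  then show ?thesis using that[of i] by (simp add: prod_eq_iff)
qed

text \<open>The square at the corner and the fifth one have to cover length \<open>sqrt 2\<close> on both sides at \<open>p\<close>. The far ends of these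
two segments have distance \<open>2\<close>, so one square contains one end and the other square the other end. The
square that contains the corner \<open>p\<close> and one far end cannot contain an interior point of the other segment, which
is therefore left to the other square up to and including the corner.\<close>

lemma diagonal_pair:
  assumes r: "in_reach (p + 1) = a_bar - sqrt 2" "out_reach (p + 3) = a_bar - sqrt 2"
  obtains D D' where "{F (corner_index p), F extra} = {D, D'}" "is_square 1 D" "is_square 1 D'"
    "side_pt a_bar p 0 \<in> D" "side_pt a_bar p (sqrt 2) \<in> D"
    "side_pt a_bar p 0 \<in> D'" "side_pt a_bar (p + 3) (a_bar - sqrt 2) \<in> D'"
proof -
  let ?A = "F (corner_index p)" and ?B = "F extra"
  let ?e = "side_pt a_bar p (sqrt 2)" and ?e' = "side_pt a_bar (p + 3) (a_bar - sqrt 2)"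
  have A: "is_square 1 ?A" by (rule unitD[OF corner_index(1)])
  have AB: "closed (?A \<union> ?B)" using unit_square_closed[OF A] unit_square_closed[OF extra_unit] by blast
  have corner: "side_pt a_bar p 0 \<in> ?A" by (rule corner_index(2))
  have corner': "side_pt a_bar (p + 3) a_bar = side_pt a_bar p 0"
    by (rule side_pt_corner)
  have out: "side_pt a_bar p t \<in> ?A" if "0 \<le> t" "t \<le> out_reach p" for t
    using side_pt_between[OF unit_square_convex[OF A] corner _ that] exact_reach[of p] unfolding exact_reach_def by blast
  have inn: "side_pt a_bar (p + 3) t \<in> ?A" if "a_bar - in_reach p \<le> t" "t \<le> a_bar" for t
    using side_pt_between[OF unit_square_convex[OF A] _ _ that] exact_reach[of p] corner corner' unfolding exact_reach_def by metis
  have one: "side_pt a_bar p t \<in> ?A \<union> ?B" if "0 < t" "t < sqrt 2" for t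
  proof (cases "t \<le> out_reach p")
    case True then show ?thesis using out that by simp
  next
    case False then show ?thesis using gap_point[of p t] that r(1) by simp
  qed
  have two: "side_pt a_bar (p + 3) t \<in> ?A \<union> ?B" if "a_bar - sqrt 2 < t" "t < a_bar" for t
  proof (cases "a_bar - in_reach p \<le> t")
    case True then show ?thesis using inn that by simp
  next
    case False then show ?thesis using gap_point[of "p + 3" t] that r(2) reach_of_Suc3[of p] by simp
  qed
  have e: "?e \<in> ?A \<union> ?B" using side_pt_closed_ends(2)[OF AB, of 0 "sqrt 2"] one by simp
  have e': "?e' \<in> ?A \<union> ?B" using side_pt_closed_ends(1)[OF AB, of "a_bar - sqrt 2" a_bar] two by simp
  have far: "dist (side_pt a_bar (p + 3) t) (side_pt a_bar p t') = sqrt ((a_bar - t)\<^sup>2 + t'\<^sup>2)" for t t'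
    using dist_side_pt_Suc[of a_bar "p + 3" t t'] side_pt_Suc3 by simp
  have apart: "\<not> (side_pt a_bar (p + 3) t \<in> X \<and> side_pt a_bar p t' \<in> X)"
    if "is_square 1 X" "2 < (a_bar - t)\<^sup>2 + t'\<^sup>2" for X t t'
    using unit_square_diameter[OF that(1)] far[of t t'] that(2) by (metis linorder_not_less real_sqrt_le_iff)
  have s2: "0 < sqrt 2" by simp
  show ?thesis
  proof (cases "?e \<in> ?A")
    case True
    have nA: "side_pt a_bar (p + 3) t \<notin> ?A" if "a_bar - sqrt 2 < t" "t < a_bar" for t
      using apart[OF A, of t "sqrt 2"] True that by simp
    have ends: "?e' \<in> ?B" "side_pt a_bar (p + 3) a_bar \<in> ?B"
      using side_pt_closed_ends[OF unit_square_closed[OF extra_unit], of "a_bar - sqrt 2" a_bar a_bar "p + 3"] two nA by auto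
    show ?thesis
      by (rule that[of ?A ?B]) (use A extra_unit corner True ends corner' in auto)
  next
    case False
    then have eB: "?e \<in> ?B" using e by blast
    have "?e' \<notin> ?B" using apart[OF extra_unit, of "a_bar - sqrt 2" "sqrt 2"] eB by simp
    then have eA: "?e' \<in> ?A" using e' by blast
    have nA: "side_pt a_bar p t \<notin> ?A" if "0 < t" "t < sqrt 2" for t
      using apart[OF A, of "a_bar - sqrt 2" t] eA that by simp
    have ends: "side_pt a_bar p 0 \<in> ?B"
      using side_pt_closed_ends(1)[OF unit_square_closed[OF extra_unit], of 0 "sqrt 2" a_bar p] one nA by auto
    show ?thesis
      by (rule that[of ?B ?A]) (use A extra_unit corner eA eB ends in auto)
  qed
qed

text \<open>Turning the special corner to \<open>(a_bar, a_bar)\<close>, every square is recognised by points that determine it.\<close>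

theorem five_squares_up_to_turn: "\<exists>k. (\<lambda>i. (turn a_bar ^^ k) ` F i) ` {..<5} = five_squares"
proof -
  obtain p where p: "reach_of (p + 1) = (short_reach x_bar, x_bar)" "reach_of (p + 2) = (1, 1)"
    "reach_of (p + 3) = (x_bar, short_reach x_bar)" by (rule special_corner)
  have fx: "short_reach x_bar = a_bar - sqrt 2" by (rule short_reach_x_bar)
  obtain D D' where D: "{F (corner_index p), F extra} = {D, D'}" "is_square 1 D" "is_square 1 D'"
    "side_pt a_bar p 0 \<in> D" "side_pt a_bar p (sqrt 2) \<in> D"
    "side_pt a_bar p 0 \<in> D'" "side_pt a_bar (p + 3) (a_bar - sqrt 2) \<in> D'"
    by (rule diagonal_pair[of p]) (use p fx in auto)
  \<comment> \<open>corner \<open>p\<close> is moved to position \<open>4 * p + 2\<close>, that is, to corner \<open>2\<close>\<close>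
  define h where "h = turn a_bar ^^ (3 * p + 2)"
  have h: "plane_isometry h" unfolding h_def by (intro plane_isometry_funpow plane_isometry_turn)
  have al: "h (side_pt a_bar (p + j) t) = side_pt a_bar (2 + j) t" for j t
    unfolding h_def by (rule align[of _ _ p]) simp
  have pts: "h (side_pt a_bar p t) = pt (a_bar - t) a_bar" "h (side_pt a_bar (p + 1) t) = pt 0 (a_bar - t)"
    "h (side_pt a_bar (p + 2) t) = pt t 0" "h (side_pt a_bar (p + 3) t) = pt a_bar t" for t
  proof -
    have "(2::nat) + 3 = Suc 0 + 4" "(2::nat) + 2 = 0 + 4" "(2::nat) + 1 = 3" "(2::nat) + 0 = 2" by simp_all
    then show "h (side_pt a_bar p t) = pt (a_bar - t) a_bar" "h (side_pt a_bar (p + 1) t) = pt 0 (a_bar - t)"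
      "h (side_pt a_bar (p + 2) t) = pt t 0" "h (side_pt a_bar (p + 3) t) = pt a_bar t"
      using al[of 0 t] al[of 1 t] al[of 2 t] al[of 3 t] side_pt_plus4(1)[of a_bar "Suc 0" t] side_pt_plus4(1)[of a_bar 0 t]
      by (simp_all only: side_pt_eqs add_0_right)
  qed
  have sq: "is_square 1 (h ` X)" if "is_square 1 X" for X using is_square_isometry[OF h that] .
  have hm: "h z \<in> h ` X" if "z \<in> X" for z X using that by blast
  have C1: "h ` F (corner_index (p + 1)) = (\<lambda>p. vector [p$2, p$1]) ` tilted_square"
  proof (rule tilted_square_swap_unique[OF sq[OF unitD[OF corner_index(1)]]])
    have m: "side_pt a_bar (p + 1) 0 \<in> F (corner_index (p + 1))" by (rule corner_index(2))
    have m': "side_pt a_bar (p + 1) x_bar \<in> F (corner_index (p + 1))"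
      "side_pt a_bar p (a_bar - short_reach x_bar) \<in> F (corner_index (p + 1))"
      using exact_reach[of "p + 1"] p(1) side_pt_Suc3[of a_bar p] unfolding exact_reach_def by (simp_all add: eval_nat_numeral)
    show "pt 0 1 \<in> h ` F (corner_index (p + 1))" "pt 0 a_bar \<in> h ` F (corner_index (p + 1))"
      "pt (short_reach x_bar) a_bar \<in> h ` F (corner_index (p + 1))"
      using hm[OF m] hm[OF m'(1)] hm[OF m'(2)] unfolding pts by (simp_all add: a_bar_def)
  qed
  have C2: "h ` F (corner_index (p + 2)) = axis_square 1"
  proof (rule unit_square_axis_unique[OF sq[OF unitD[OF corner_index(1)]]])
    have m: "side_pt a_bar (p + 2) 0 \<in> F (corner_index (p + 2))" by (rule corner_index(2))
    have m': "side_pt a_bar (p + 2) 1 \<in> F (corner_index (p + 2))"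
      "side_pt a_bar (p + 1) (a_bar - 1) \<in> F (corner_index (p + 2))"
      using exact_reach[of "p + 2"] p(2) side_pt_Suc3[of a_bar "p + 1"] unfolding exact_reach_def by (simp_all add: eval_nat_numeral)
    show "pt 0 0 \<in> h ` F (corner_index (p + 2))" "pt 1 0 \<in> h ` F (corner_index (p + 2))"
      "pt 0 1 \<in> h ` F (corner_index (p + 2))"
      using hm[OF m] hm[OF m'(1)] hm[OF m'(2)] unfolding pts by simp_all
  qed
  have C3: "h ` F (corner_index (p + 3)) = tilted_square"
  proof (rule tilted_square_unique[OF sq[OF unitD[OF corner_index(1)]]])
    have m: "side_pt a_bar (p + 3) 0 \<in> F (corner_index (p + 3))" by (rule corner_index(2))
    have m': "side_pt a_bar (p + 3) (short_reach x_bar) \<in> F (corner_index (p + 3))"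
      "side_pt a_bar (p + 2) (a_bar - x_bar) \<in> F (corner_index (p + 3))"
      using exact_reach[of "p + 3"] p(3) side_pt_Suc3[of a_bar "p + 2"] unfolding exact_reach_def by (simp_all add: eval_nat_numeral)
    show "pt 1 0 \<in> h ` F (corner_index (p + 3))" "pt a_bar 0 \<in> h ` F (corner_index (p + 3))"
      "pt a_bar (short_reach x_bar) \<in> h ` F (corner_index (p + 3))"
      using hm[OF m] hm[OF m'(1)] hm[OF m'(2)] unfolding pts by (simp_all add: a_bar_def)
  qed
  have C4: "h ` D = square_with_diagonal (vector [a_bar - sqrt 2, a_bar]) (vector [a_bar, a_bar])"
  proof (rule square_with_diagonal_unique[OF sq[OF D(2)]])
    show "pt (a_bar - sqrt 2) a_bar \<in> h ` D" "pt a_bar a_bar \<in> h ` D"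
      using hm[OF D(4)] hm[OF D(5)] unfolding pts by simp_all
  qed (simp add: dist_plane)
  have C5: "h ` D' = square_with_diagonal (vector [a_bar, a_bar - sqrt 2]) (vector [a_bar, a_bar])"
  proof (rule square_with_diagonal_unique[OF sq[OF D(3)]])
    show "pt a_bar (a_bar - sqrt 2) \<in> h ` D'" "pt a_bar a_bar \<in> h ` D'"
      using hm[OF D(6)] hm[OF D(7)] unfolding pts by simp_all
  qed (simp add: dist_plane)
  have "(\<lambda>i. h ` F i) ` {..<5} = (\<lambda>X. h ` X) ` ({F (corner_index p), F extra} \<union>
      {F (corner_index (p + 1)), F (corner_index (p + 2)), F (corner_index (p + 3))})"
    unfolding indices corner_index_image[of p] by auto
  also have "\<dots> = five_squares"
    unfolding D(1) five_squares_def image_Un image_insert image_empty C1 C2 C3 C4 C5 by auto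
  finally show ?thesis unfolding h_def by blast
qed

end

lemma five_covering_unique:
  assumes S: "is_square a_bar S" and F: "unit_square_family 5 F" "covers 5 F (frontier S)"
  shows "\<exists>g. plane_isometry g \<and> g ` S = axis_square a_bar \<and> (\<lambda>i. g ` F i) ` {..<5} = five_squares"
proof -
  obtain g where g: "plane_isometry g" "g ` S = axis_square a_bar" using is_square_axis[OF S] by blast
  have "sqrt 2 < a_bar" using x_bar_bounds sqrt2_bounds unfolding a_bar_def by linarith
  then interpret five_covering "\<lambda>i. g ` F i"
    unfolding five_covering_def by (rule boundary_covering_image[OF _ g F])
  obtain k where k: "(\<lambda>i. (turn a_bar ^^ k) ` g ` F i) ` {..<5} = five_squares"
    using five_squares_up_to_turn by blast
  let ?g = "(turn a_bar ^^ k) \<circ> g"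
  have "plane_isometry ?g" by (intro plane_isometry_comp plane_isometry_funpow plane_isometry_turn g)
  moreover have "?g ` S = axis_square a_bar" unfolding image_comp[symmetric] g(2) turn_pow_axis_square ..
  moreover have "(\<lambda>i. ?g ` F i) ` {..<5} = five_squares" using k by (simp only: image_comp)
  ultimately show ?thesis by blast
qed

lemma a_bar_approx: "\<bar>a_bar - 2.072\<bar> < 0.0005"
  using x_bar_bounds unfolding a_bar_def by auto

theorem theorem1p4:
  shows
    "(\<forall>n\<ge>4. S_bd (n + 4) = S_bd n + sqrt 2) \<and>
     (S_bd 4 = 2 \<and>
      (\<forall>S F. is_square 2 S \<and> unit_square_family 4 F \<and> covers 4 F (frontier S) \<longrightarrow>
         (\<forall>i<4. homothetic (F i) S))) \<and>
     (S_bd 5 = 1 / 2 * sqrt 2 * sqrt (sqrt (13 - 8 * sqrt 2) + 1) + 1 \<and>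
      \<bar>S_bd 5 - 2.072\<bar> < 0.0005 \<and>
      (\<forall>S F. is_square (S_bd 5) S \<and> unit_square_family 5 F \<and> covers 5 F (frontier S) \<longrightarrow>
         (\<exists>g. plane_isometry g \<and> g ` S = axis_square a_bar \<and>
              (\<lambda>i. g ` F i) ` {..<5} = five_squares)))"
proof (intro conjI allI impI)
  show "S_bd (n + 4) = S_bd n + sqrt 2" if "4 \<le> n" for n by (rule S_bd_add_4[OF that])
  show "S_bd 4 = 2" by (rule S_bd_4)
  show "homothetic (F i) S"
    if "is_square 2 S \<and> unit_square_family 4 F \<and> covers 4 F (frontier S)" "i < 4" for S F i
    using that four_squares_homothetic by blast
  show "S_bd 5 = 1 / 2 * sqrt 2 * sqrt (sqrt (13 - 8 * sqrt 2) + 1) + 1"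
    by (simp add: S_bd_5 a_bar_def x_bar_def)
  show "\<bar>S_bd 5 - 2.072\<bar> < 0.0005" unfolding S_bd_5 by (rule a_bar_approx)
  show "\<exists>g. plane_isometry g \<and> g ` S = axis_square a_bar \<and> (\<lambda>i. g ` F i) ` {..<5} = five_squares"
    if "is_square (S_bd 5) S \<and> unit_square_family 5 F \<and> covers 5 F (frontier S)" for S F
    using that five_covering_unique unfolding S_bd_5 by blast
qed

end
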